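(* Let $n$ and $m$ be positive even integers and let $O$ be an Eulerian orientation of the complete bipartite graph $K_{n,m}$. Then $$\mathrm{arb}(O)\geq \left(\frac{m}{2}\right)^{n-1}\left(\frac{n}{2}\right)^{m-1}.$$ The following orientation of $K_{n,m}$ achieves the lower bound and is the unique minimizer of $\mathrm{arb}$ among Eulerian orientations of $K_{n,m}$ up to isomorphism: take a directed $4$-cycle and blow up the vertices alternately, replacing every second vertex by $\frac n2$ vertices and each of the other two vertices by $\frac m2$ vertices.
   Context: $K_{n,m}$ is the complete bipartite graph with parts of size $n$ and $m$. An orientation is Eulerian if every vertex has equal in-degree and out-degree. An arborescence of a directed graph $D$ rooted at a vertex $v$ is a spanning tree of $D$ in which every vertex different from $v$ has out-degree $1$ and $v$ has out-degree $0$ (every edge is oriented towards the root). $\mathrm{arb}(D,v)$ is the number of arborescences of $D$ rooted at $v$; for an Eulerian digraph $D$ it does not depend on $v$ and is denoted $\mathrm{arb}(D)$. The blow-up described is explicitly the digraph on disjoint vertex sets $V_1,V_2,V_3,V_4$ with $|V_1|=|V_3|=\frac n2$, $|V_2|=|V_4|=\frac m2$, whose edges are all pairs directed from $V_1$ to $V_2$, from $V_2$ to $V_3$, from $V_3$ to $V_4$ and from $V_4$ to $V_1$. Isomorphism means isomorphism of directed graphs. *)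

theory Defs
  imports "Graph_Theory.Graph_Theory"
begin

text \<open>
  As in the library, an undirected simple graph is a symmetric digraph. Since graphs and their
  orientations have no parallel arcs, arcs are pairs of vertices.
\<close>

definition orientation :: "'a pair_pre_digraph \<Rightarrow> 'a pair_pre_digraph \<Rightarrow> bool" where
  "orientation D G \<longleftrightarrow>
     pverts D = pverts G \<and> parcs D \<subseteq> parcs G \<and>
     (\<forall>u v. (u, v) \<in> parcs G \<longrightarrow> ((u, v) \<in> parcs D) \<noteq> ((v, u) \<in> parcs D))"

definition eulerian_orientation :: "'a pair_pre_digraph \<Rightarrow> 'a pair_pre_digraph \<Rightarrow> bool" where
  "eulerian_orientation D G \<longleftrightarrow>
     orientation D G \<and> (\<forall>v \<in> pverts D. in_degree (with_proj D) v = out_degree (with_proj D) v)"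

text \<open>
  The library's \<^const>\<open>forest\<close> excludes only directed cycles (loops and pairs of antiparallel arcs
  among them), so a transitive triangle would be a tree. A tree in the usual sense must have no
  cycle in its underlying undirected graph either; in the symmetric closure these are the cycles
  of length at least 3, as \<open>u, v, u\<close> traverses one undirected edge twice.
\<close>

definition undirected_spanning_tree :: "'a pair_pre_digraph \<Rightarrow> 'a pair_pre_digraph \<Rightarrow> bool" where
  "undirected_spanning_tree T D \<longleftrightarrow>
     spanning_tree (with_proj T) (with_proj D) \<and>
     \<not> (\<exists>p. pre_digraph.cycle (with_proj (mk_symmetric (with_proj T))) p \<and> 3 \<le> length p)"

definition arborescence :: "'a pair_pre_digraph \<Rightarrow> 'a \<Rightarrow> 'a pair_pre_digraph \<Rightarrow> bool" where
  "arborescence D r T \<longleftrightarrow>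
     undirected_spanning_tree T D \<and>
     (\<forall>v \<in> pverts T. v \<noteq> r \<longrightarrow> out_degree (with_proj T) v = 1) \<and>
     r \<in> pverts T \<and> out_degree (with_proj T) r = 0"

text \<open>
  For an orientation with equal in- and out-degrees the number does not depend on the root. The
  root is kept as an argument so that statements quantify over it instead of presupposing this.
\<close>

definition arb :: "'a pair_pre_digraph \<Rightarrow> 'a \<Rightarrow> nat" where
  "arb D r = card {T. arborescence D r T}"

definition directed_cycle :: "nat \<Rightarrow> nat pair_pre_digraph" where
  "directed_cycle k = \<lparr>pverts = {..<k}, parcs = {(i, (i + 1) mod k) | i. i < k}\<rparr>"

definition blow_up :: "'a pair_pre_digraph \<Rightarrow> ('a \<Rightarrow> nat) \<Rightarrow> ('a \<times> nat) pair_pre_digraph" where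
  "blow_up D s =
     \<lparr>pverts = {(v, k). v \<in> pverts D \<and> k < s v},
      parcs = {((u, k), (v, l)) | u k v l. (u, v) \<in> parcs D \<and> k < s u \<and> l < s v}\<rparr>"

definition cycle4_blow_up :: "nat \<Rightarrow> nat \<Rightarrow> (nat \<times> nat) pair_pre_digraph" where
  "cycle4_blow_up n m = blow_up (directed_cycle 4) (\<lambda>i. if even i then n div 2 else m div 2)"

text \<open>The vertices \<open>0, 2\<close> of the 4-cycle are replaced by \<open>n/2\<close> vertices each, \<open>1, 3\<close> by \<open>m/2\<close> each.\<close>

lemma cycle4_blow_up_explicit:
  fixes n m :: nat
  defines "V1 \<equiv> {0 :: nat} \<times> {..<n div 2}" and "V2 \<equiv> {1 :: nat} \<times> {..<m div 2}"
    and "V3 \<equiv> {2 :: nat} \<times> {..<n div 2}" and "V4 \<equiv> {3 :: nat} \<times> {..<m div 2}"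
  shows "cycle4_blow_up n m =
    \<lparr>pverts = V1 \<union> V2 \<union> V3 \<union> V4,
     parcs = V1 \<times> V2 \<union> V2 \<times> V3 \<union> V3 \<times> V4 \<union> V4 \<times> V1\<rparr>"
proof -
  have *: "{..<4 :: nat} = {0, 1, 2, 3}"
    by auto
  have **: "{(i, (i + 1) mod 4) | i. i < (4 :: nat)} = {(0, 1), (1, 2), (2, 3), (3, 0)}"
    (is "?L = ?R")
  proof -
    have "?L = (\<lambda>i. (i, (i + 1) mod 4)) ` {..<4}" by auto
    also have "\<dots> = ?R" unfolding * by (simp add: Suc_eq_plus1 del: One_nat_def)
    finally show ?thesis .
  qed
  let ?s = "\<lambda>i :: nat. if even i then n div 2 else m div 2"
  have "{(v, k). v \<in> {0, 1, 2, 3} \<and> k < ?s v} = V1 \<union> V2 \<union> V3 \<union> V4"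
    unfolding assms by (auto split: if_splits)
  moreover have "{((u, k), (v, l)) | u k v l.
      (u, v) \<in> {(0, 1), (1, 2), (2, 3), (3, 0)} \<and> k < ?s u \<and> l < ?s v} =
    V1 \<times> V2 \<union> V2 \<times> V3 \<union> V3 \<times> V4 \<union> V4 \<times> V1" (is "?A = ?B")
  proof (intro set_eqI)
    fix e :: "(nat \<times> nat) \<times> (nat \<times> nat)"
    obtain u k v l where e: "e = ((u, k), (v, l))"
      by (metis surj_pair)
    have A: "e \<in> ?A \<longleftrightarrow>
      (u, v) \<in> {(0, 1), (1, 2), (2, 3), (3, 0)} \<and> k < ?s u \<and> l < ?s v"
      unfolding e by blast
    show "e \<in> ?A \<longleftrightarrow> e \<in> ?B"
      unfolding A unfolding e assms
      by (cases "u = 0"; cases "u = 1"; cases "u = 2"; cases "u = 3") auto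
  qed
  ultimately show ?thesis
    unfolding cycle4_blow_up_def blow_up_def directed_cycle_def
    by (simp only: pair_pre_digraph.simps * **)
qed

end

theory Submission
  imports
    Defs
    "Jordan_Normal_Form.Schur_Decomposition"
    "HOL-Library.FuncSet"
begin

text \<open>
  Let \<open>U\<close> and \<open>W\<close> be the two parts, of sizes \<open>n\<close> and \<open>m\<close>, and encode the orientation by the \<open>n \<times> m\<close> matrix
  \<open>S\<close> whose entry at \<open>(u, w)\<close> is \<open>1\<close> if the edge points from \<open>u\<close> to \<open>w\<close> and \<open>-1\<close> otherwise. The orientation
  is Eulerian exactly if all rows and columns of \<open>S\<close> sum to \<open>0\<close>; the out-degrees are then \<open>m / 2\<close> on \<open>U\<close> and
  \<open>n / 2\<close> on \<open>W\<close>.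

  By the matrix-tree theorem the number of arborescences is the determinant of the out-degree
  Laplacian in which the row of the root is replaced by a unit vector
  (\<open>matrix_tree_choices\<close>, \<open>arb_eq_card_root_choices\<close>). The rows and the columns of the Laplacian sum
  to zero, so adding \<open>1 / 2\<close> to each of its entries, instead of replacing a row, gives a matrix whose
  determinant is \<open>(n + m)\<^sup>2 / 2\<close> times the one sought (\<open>det_add_const_zero_sums\<close>).
  It also turns the two off-diagonal blocks into \<open>- S / 2\<close> and \<open>S\<^sup>T / 2\<close>, and block elimination yields (\<open>det_sign_laplacian_reduced\<close>)

  \<open>arb = (m / 2) ^ (n - 1) * (n / 2) ^ (m - 1) * det (1 + G) / 2\<close> with \<open>G = S S\<^sup>T / (n m)\<close>.

  The matrix \<open>G\<close> is positive semidefinite and its trace is \<open>1\<close>. With eigenvalues \<open>\<lambda>\<close> of \<open>G\<close>, the determinant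
  of \<open>1 + G\<close> is \<open>\<Prod> (1 + \<lambda>) \<ge> 1 + \<Sum> \<lambda> = 2\<close>, which is the bound. Equality holds iff all products of two
  eigenvalues at different positions vanish, that is iff the trace of \<open>G\<^sup>2\<close> equals the square of the
  trace of \<open>G\<close> (\<open>det_one_plus_gram\<close>). For the sign matrix \<open>S\<close> this is equality in the Cauchy-Schwarz
  inequality for every pair of rows: any two rows are equal or opposite
  (\<open>det_one_plus_sign_gram\<close>). So the out-neighbourhoods of any two vertices of \<open>U\<close> are equal or
  disjoint, and this describes precisely the blow-ups of the directed 4-cycle
  (\<open>iso_imp_equal_or_disjoint\<close>, \<open>equal_or_disjoint_imp_iso\<close>).
\<close>

section \<open>The determinant of one plus a Gram matrix\<close>

text \<open>
  The product is the sum of all elementary symmetric functions of the list. The bound keeps those of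
  degree at most 2, and the one of degree 2 is expressed by power sums, which traces compute.
\<close>

lemma prod_list_one_plus_ge:
  fixes es :: "real list"
  assumes "\<forall>e \<in> set es. 0 \<le> e"
  shows "(\<Sum>e\<leftarrow>es. e\<^sup>2) \<le> (sum_list es)\<^sup>2"
    and "1 + sum_list es + ((sum_list es)\<^sup>2 - (\<Sum>e\<leftarrow>es. e\<^sup>2)) / 2 \<le> (\<Prod>e\<leftarrow>es. 1 + e)"
  using assms
proof (induction es)
  case (Cons x es)
  {
    case 1
    have "0 \<le> x * sum_list es" using 1 by (intro mult_nonneg_nonneg sum_list_nonneg) auto
    with 1 Cons.IH show ?case by (auto simp: power2_sum)
  next
    case 2
    define s where "s = sum_list es"
    define q where "q = ((sum_list es)\<^sup>2 - (\<Sum>e\<leftarrow>es. e\<^sup>2)) / 2"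
    have "0 \<le> q" "0 \<le> x" using 2 Cons by (auto simp: q_def)
    then have "1 + (x + s) + (q + x * s) \<le> (1 + x) * (1 + s + q)"
      by (simp add: algebra_simps)
    also have "\<dots> \<le> (1 + x) * (\<Prod>e\<leftarrow>es. 1 + e)"
      using 2 Cons \<open>0 \<le> x\<close> by (intro mult_left_mono) (auto simp: s_def q_def)
    finally show ?case by (simp add: s_def q_def power2_sum field_simps)
  }
qed auto

text \<open>
  The hypothesis says that the second elementary symmetric function vanishes. For nonnegative numbers
  this leaves at most one nonzero entry.
\<close>

lemma prod_list_one_plus_eq:
  fixes es :: "real list"
  assumes "\<forall>e \<in> set es. 0 \<le> e" and "(sum_list es)\<^sup>2 = (\<Sum>e\<leftarrow>es. e\<^sup>2)"
  shows "(\<Prod>e\<leftarrow>es. 1 + e) = 1 + sum_list es"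
  using assms
proof (induction es)
  case (Cons x es)
  have "0 \<le> sum_list es" using Cons.prems by (intro sum_list_nonneg) auto
  then have xs: "0 \<le> x * sum_list es" using Cons.prems by auto
  have "(sum_list es)\<^sup>2 + 2 * (x * sum_list es) = (\<Sum>e\<leftarrow>es. e\<^sup>2)"
    using Cons.prems(2) by (simp add: power2_sum)
  moreover have "(\<Sum>e\<leftarrow>es. e\<^sup>2) \<le> (sum_list es)\<^sup>2"
    using Cons.prems(1) by (intro prod_list_one_plus_ge) auto
  ultimately have "(sum_list es)\<^sup>2 = (\<Sum>e\<leftarrow>es. e\<^sup>2)" "x * sum_list es = 0"
    using xs by linarith+
  with Cons show ?case by (simp add: algebra_simps)
qed simp

definition trace_mat :: "'a :: comm_monoid_add mat \<Rightarrow> 'a" where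
  "trace_mat A = (\<Sum>i<dim_row A. A $$ (i, i))"

lemma trace_mat_mult:
  assumes "A \<in> carrier_mat n k" "B \<in> carrier_mat k n"
  shows "trace_mat (A * B) = (\<Sum>i<n. \<Sum>j<k. A $$ (i, j) * B $$ (j, i))"
  using assms by (auto simp: trace_mat_def scalar_prod_def atLeast0LessThan intro!: sum.cong)

lemma trace_mat_mult_commute:
  fixes A :: "'a :: comm_semiring_0 mat"
  assumes "A \<in> carrier_mat n k" "B \<in> carrier_mat k n"
  shows "trace_mat (A * B) = trace_mat (B * A)"
  unfolding trace_mat_mult[OF assms] trace_mat_mult[OF assms(2,1)]
  by (subst sum.swap) (simp add: mult.commute)

lemma trace_mat_similar:
  fixes A :: "'a :: comm_ring_1 mat"
  assumes "similar_mat_wit A B P Q"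
  shows "trace_mat A = trace_mat B"
proof -
  define n where "n = dim_row A"
  note w = similar_mat_witD[OF n_def assms]
  have "trace_mat A = trace_mat ((P * B) * Q)" using w(3) by simp
  also have "\<dots> = trace_mat (Q * (P * B))"
    using w by (intro trace_mat_mult_commute) auto
  also have "Q * (P * B) = (Q * P) * B"
    using w by (intro assoc_mult_mat[symmetric]) auto
  finally show ?thesis using w by simp
qed

lemma trace_mat_upper_triangular_square:
  fixes B :: "'a :: comm_ring_1 mat"
  assumes "B \<in> carrier_mat n n" "upper_triangular B"
  shows "trace_mat (B * B) = (\<Sum>e\<leftarrow>diag_mat B. e\<^sup>2)"
proof -
  have "trace_mat (B * B) = (\<Sum>i<n. \<Sum>j<n. B $$ (i, j) * B $$ (j, i))"
    using assms by (intro trace_mat_mult) auto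
  also have "\<dots> = (\<Sum>i<n. \<Sum>j<n. if j = i then (B $$ (i, i))\<^sup>2 else 0)"
    using assms upper_triangularD[OF assms(2)]
    by (intro sum.cong refl) (auto simp: power2_eq_square, metis mult_not_zero nat_neq_iff)
  also have "\<dots> = (\<Sum>i<n. (B $$ (i, i))\<^sup>2)" by simp
  also have "\<dots> = (\<Sum>e\<leftarrow>diag_mat B. e\<^sup>2)"
    using assms by (simp add: diag_mat_def comp_def sum_list_distinct_conv_sum_set atLeast0LessThan)
  finally show ?thesis .
qed

text \<open>
  A Schur triangularisation of \<open>A\<close> has the eigenvalues on its diagonal, with multiplicity, and
  similarity preserves all three quantities.
\<close>

lemma eigenvalue_list:
  fixes A :: "complex mat"
  assumes A: "A \<in> carrier_mat n n"
  obtains es where "\<forall>e \<in> set es. eigenvalue A e" "det (1\<^sub>m n + A) = (\<Prod>e\<leftarrow>es. 1 + e)"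
    "trace_mat A = sum_list es" "trace_mat (A * A) = (\<Sum>e\<leftarrow>es. e\<^sup>2)"
proof -
  obtain es where es: "char_poly A = (\<Prod>e\<leftarrow>es. [:- e, 1:])"
    using char_poly_factorized[OF A] by auto
  obtain B P Q where "schur_decomposition A es = (B, P, Q)" by (metis prod_cases3)
  from schur_decomposition[OF A es this]
  have sim: "similar_mat_wit A B P Q" and tri: "upper_triangular B" and diag: "diag_mat B = es"
    by auto
  have n: "n = dim_row A" using A by auto
  note w = similar_mat_witD[OF n sim]
  have "eigenvalue A e" if "e \<in> set es" for e
    using that eigenvalue_root_char_poly[OF A] unfolding es poly_prod_list prod_list_zero_iff
    by force
  moreover have "det (1\<^sub>m n + A) = (\<Prod>e\<leftarrow>es. 1 + e)"
  proof -
    have "similar_mat_wit (1\<^sub>m n + A) (1\<^sub>m n + B) P Q"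
    proof (rule similar_mat_witI[OF w(1,2)])
      show "1\<^sub>m n + A = P * (1\<^sub>m n + B) * Q"
        using w by (simp add: mult_add_distrib_mat[of P n n _ n] add_mult_distrib_mat[of _ n n _ _ n])
    qed (use w in auto)
    then have "det (1\<^sub>m n + A) = det (1\<^sub>m n + B)"
      unfolding similar_mat_def by (intro det_similar) (auto simp: similar_mat_def)
    also have "\<dots> = prod_list (diag_mat (1\<^sub>m n + B))"
      using w tri by (intro det_upper_triangular[of _ n]) (auto simp: upper_triangular_def)
    also have "diag_mat (1\<^sub>m n + B) = map (\<lambda>e. 1 + e) es"
      using w unfolding diag[symmetric] by (auto simp: diag_mat_def)
    finally show ?thesis by simp
  qed
  moreover have "trace_mat A = sum_list es"
    using trace_mat_similar[OF sim] w diag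
    by (auto simp: trace_mat_def diag_mat_def sum_list_distinct_conv_sum_set atLeast0LessThan)
  moreover have "trace_mat (A * A) = (\<Sum>e\<leftarrow>es. e\<^sup>2)"
  proof -
    have "A * A = P * B * (Q * P) * B * Q"
      unfolding w(3) using w(4-) by (simp add: assoc_mult_mat[of _ n n _ n _ n])
    then have "A * A = P * (B * B) * Q"
      using w by (simp add: assoc_mult_mat[of _ n n _ n _ n])
    then have "similar_mat_wit (A * A) (B * B) P Q"
      using w by (intro similar_mat_witI[OF w(1,2)]) auto
    from trace_mat_similar[OF this] show ?thesis
      using trace_mat_upper_triangular_square[OF _ tri] w diag by auto
  qed
  ultimately show ?thesis using that by blast
qed

text \<open>
  For an eigenvector \<open>v\<close> the Hermitian form of the Gram matrix at \<open>v\<close> is both \<open>e\<close> times the squared norm of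
  \<open>v\<close> and the squared norm of \<open>X\<^sup>T v\<close>, so \<open>e\<close> is a quotient of two nonnegative numbers.
\<close>

lemma gram_eigenvalue_nonneg:
  fixes X :: "real mat"
  assumes X: "X \<in> carrier_mat n k"
    and ev: "eigenvalue (map_mat complex_of_real (X * X\<^sup>T)) e"
  shows "\<exists>x \<ge> 0. e = complex_of_real x"
proof -
  let ?G = "map_mat complex_of_real (X * X\<^sup>T)"
  obtain v where v: "v \<in> carrier_vec n" "v \<noteq> 0\<^sub>v n" "?G *\<^sub>v v = e \<cdot>\<^sub>v v"
    using ev X by (auto simp: eigenvalue_def eigenvector_def)
  \<comment> \<open>the entries of \<open>X\<^sup>T v\<close>\<close>
  define y where "y b = (\<Sum>i<n. complex_of_real (X $$ (i, b)) * v $ i)" for b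
  have "(\<Sum>b<k. of_real (X $$ (i, b)) * y b) = e * v $ i" if "i < n" for i
  proof -
    have "e * v $ i = (?G *\<^sub>v v) $ i" using v that by simp
    also have "\<dots> = (\<Sum>j<n. (\<Sum>b<k. of_real (X $$ (i, b)) * of_real (X $$ (j, b))) * v $ j)"
      using that X v(1) by (simp add: scalar_prod_def atLeast0LessThan)
    also have "\<dots> = (\<Sum>b<k. of_real (X $$ (i, b)) * y b)"
      unfolding y_def sum_distrib_left sum_distrib_right
      by (subst sum.swap) (simp add: mult.assoc)
    finally show ?thesis ..
  qed
  then have "(\<Sum>i<n. cnj (v $ i) * (\<Sum>b<k. of_real (X $$ (i, b)) * y b))
      = (\<Sum>i<n. e * (v $ i * cnj (v $ i)))"
    by (intro sum.cong) (auto simp: mult_ac)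
  moreover have "(\<Sum>i<n. cnj (v $ i) * (\<Sum>b<k. of_real (X $$ (i, b)) * y b))
      = (\<Sum>b<k. y b * cnj (y b))"
    unfolding y_def cnj_sum sum_distrib_left sum_distrib_right
    by (subst sum.swap) (auto intro!: sum.cong simp: sum_distrib_left mult_ac)
  ultimately have "(\<Sum>b<k. y b * cnj (y b)) = e * (\<Sum>i<n. v $ i * cnj (v $ i))"
    by (simp add: sum_distrib_left)
  then have eq: "of_real (\<Sum>b<k. (cmod (y b))\<^sup>2) = e * of_real (\<Sum>i<n. (cmod (v $ i))\<^sup>2)"
    by (simp add: complex_norm_square[symmetric] del: of_real_power)
  have "(\<Sum>i<n. (cmod (v $ i))\<^sup>2) \<noteq> 0"
  proof
    assume "(\<Sum>i<n. (cmod (v $ i))\<^sup>2) = 0"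
    then have "\<forall>i<n. v $ i = 0" by (subst (asm) sum_nonneg_eq_0_iff) auto
    then show False using v by auto
  qed
  then have "e = of_real ((\<Sum>b<k. (cmod (y b))\<^sup>2) / (\<Sum>i<n. (cmod (v $ i))\<^sup>2))"
    using eq by (simp only: of_real_divide) (simp add: nonzero_eq_divide_eq del: of_real_sum of_real_power)
  then show ?thesis
    by (intro exI[of _ "(\<Sum>b<k. (cmod (y b))\<^sup>2) / (\<Sum>i<n. (cmod (v $ i))\<^sup>2)"])
       (auto intro!: divide_nonneg_nonneg sum_nonneg)
qed

text \<open>
  All eigenvalues of \<open>G\<close> are nonnegative, so the lower bound on \<open>\<Prod> (1 + e)\<close> and its equality case apply
  to them. The equality case is phrased with traces because these are computable from the entries of \<open>X\<close>.
\<close>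

lemma det_one_plus_gram:
  fixes X :: "real mat"
  assumes X: "X \<in> carrier_mat n k"
  defines "G \<equiv> X * X\<^sup>T"
  shows "1 + trace_mat G \<le> det (1\<^sub>m n + G)"
    and "det (1\<^sub>m n + G) = 1 + trace_mat G \<longleftrightarrow> trace_mat (G * G) = (trace_mat G)\<^sup>2"
proof -
  let ?c = "map_mat complex_of_real"
  have G: "G \<in> carrier_mat n n" using X by (auto simp: G_def)
  have cG: "?c G \<in> carrier_mat n n" using G by auto
  obtain es where es: "\<forall>e \<in> set es. eigenvalue (?c G) e"
    "det (1\<^sub>m n + ?c G) = (\<Prod>e\<leftarrow>es. 1 + e)"
    "trace_mat (?c G) = sum_list es" "trace_mat (?c G * ?c G) = (\<Sum>e\<leftarrow>es. e\<^sup>2)"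
    by (rule eigenvalue_list[OF cG])
  define rs where "rs = map Re es"
  have e: "e = of_real (Re e) \<and> 0 \<le> Re e" if "e \<in> set es" for e
    using es(1) that gram_eigenvalue_nonneg[OF X, of e] by (auto simp: G_def)
  then have es_rs: "es = map complex_of_real rs"
    by (auto simp: rs_def comp_def intro!: map_idI[symmetric])
  have rs: "\<forall>e \<in> set rs. 0 \<le> e" using e by (auto simp: rs_def)
  have sum_c: "sum_list (map (\<lambda>e. complex_of_real (h e)) xs) = of_real (\<Sum>e\<leftarrow>xs. h e)" for h xs
    by (induction xs) auto
  have prod_c: "prod_list (map (\<lambda>e. 1 + complex_of_real e) xs) = of_real (\<Prod>e\<leftarrow>xs. 1 + e)" for xs
    by (induction xs) auto
  have tr_c: "trace_mat (?c A) = of_real (trace_mat A)" if "A \<in> carrier_mat n n" for A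
    using that by (simp add: trace_mat_def)
  have "det (1\<^sub>m n + ?c G) = of_real (det (1\<^sub>m n + G))"
  proof -
    have "1\<^sub>m n + ?c G = ?c (1\<^sub>m n + G)" using G by (auto intro!: eq_matI)
    then show ?thesis by (simp add: of_real_hom.hom_det)
  qed
  then have "complex_of_real (det (1\<^sub>m n + G)) = of_real (\<Prod>e\<leftarrow>rs. 1 + e)"
    using es(2) prod_c[of rs] by (simp add: es_rs comp_def)
  then have 1: "det (1\<^sub>m n + G) = (\<Prod>e\<leftarrow>rs. 1 + e)"
    by (simp only: of_real_eq_iff)
  have 2: "trace_mat G = sum_list rs"
    using es(3) sum_c[of "\<lambda>x. x" rs] G by (intro inj_onD[OF inj_of_real[where 'a = complex]]) (simp_all add: es_rs tr_c comp_def)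
  have "?c G * ?c G = ?c (G * G)"
    using G by (simp add: of_real_hom.mat_hom_mult)
  then have 3: "trace_mat (G * G) = (\<Sum>e\<leftarrow>rs. e\<^sup>2)"
    using es(4) sum_c[of "\<lambda>x. x\<^sup>2" rs] G by (intro inj_onD[OF inj_of_real[where 'a = complex]]) (simp_all add: es_rs tr_c comp_def)
  have arith: "1 + s \<le> p \<and> (p = 1 + s \<longrightarrow> q = s\<^sup>2)" if "q \<le> s\<^sup>2" "1 + s + (s\<^sup>2 - q) / 2 \<le> p"
    for p q s :: real
    using that by (auto simp: field_simps)
  note ge = arith[OF prod_list_one_plus_ge[OF rs]]
  show "1 + trace_mat G \<le> det (1\<^sub>m n + G)"
    unfolding 1 2 using ge by blast
  show "det (1\<^sub>m n + G) = 1 + trace_mat G \<longleftrightarrow> trace_mat (G * G) = (trace_mat G)\<^sup>2"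
    unfolding 1 2 3 using ge prod_list_one_plus_eq[OF rs] by metis
qed

section \<open>Determinants of matrices with vanishing row and column sums\<close>

lemma cofactor_diag_cong:
  assumes "A \<in> carrier_mat N N" "B \<in> carrier_mat N N" "r < N"
    and "\<And>i j. i < N \<Longrightarrow> j < N \<Longrightarrow> i \<noteq> r \<Longrightarrow> j \<noteq> r \<Longrightarrow> A $$ (i, j) = B $$ (i, j)"
  shows "cofactor A r r = cofactor B r r"
proof -
  have "mat_delete A r r = mat_delete B r r"
    using assms(1-3) by (auto simp: mat_delete_def intro!: eq_matI assms(4))
  then show ?thesis by (simp add: cofactor_def)
qed

lemma det_unit_row:
  fixes A :: "'a :: comm_ring_1 mat"
  assumes A: "A \<in> carrier_mat N N" and "r < N" "\<And>j. j < N \<Longrightarrow> j \<noteq> r \<Longrightarrow> A $$ (r, j) = 0"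
  shows "det A = A $$ (r, r) * cofactor A r r"
  unfolding laplace_expansion_row[OF A assms(2)]
  using assms(2,3) by (subst sum.remove[of _ r]) auto

lemma det_unit_col:
  fixes A :: "'a :: comm_ring_1 mat"
  assumes A: "A \<in> carrier_mat N N" and "r < N" "\<And>i. i < N \<Longrightarrow> i \<noteq> r \<Longrightarrow> A $$ (i, r) = 0"
  shows "det A = A $$ (r, r) * cofactor A r r"
  unfolding laplace_expansion_column[OF A assms(2)]
  using assms(2,3) by (subst sum.remove[of _ r]) auto

lemma cofactor_one:
  assumes "r < N"
  shows "cofactor (1\<^sub>m N :: 'a :: comm_ring_1 mat) r r = 1"
  using det_unit_row[of "1\<^sub>m N :: 'a mat" N r] assms by simp

text \<open>
  The left-hand side arises from the matrix of \<open>g\<close> by adding all other rows to row \<open>r\<close>.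
\<close>

lemma det_sum_into_row:
  fixes g :: "nat \<Rightarrow> nat \<Rightarrow> 'a :: comm_ring_1"
  assumes r: "r < N"
  shows "det (mat N N (\<lambda>(i, j). if i = r then \<Sum>k<N. g k j else g i j)) = det (mat N N (\<lambda>(i, j). g i j))"
proof -
  define E :: "'a mat" where "E = mat N N (\<lambda>(i, j). if i = r \<or> i = j then 1 else 0)"
  have "det E = E $$ (r, r) * cofactor E r r"
    using r by (intro det_unit_col[of _ N]) (auto simp: E_def)
  also have "cofactor E r r = cofactor (1\<^sub>m N) r r"
    using r by (intro cofactor_diag_cong[of _ N]) (auto simp: E_def)
  finally have "det E = 1" using r by (simp add: cofactor_one E_def)
  moreover have "mat N N (\<lambda>(i, j). if i = r then \<Sum>k<N. g k j else g i j) = E * mat N N (\<lambda>(i, j). g i j)"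
    by (rule eq_matI)
       (auto simp: E_def scalar_prod_def atLeast0LessThan if_distrib[where f = "\<lambda>x. x * y" for y]
         cong: if_cong)
  moreover have "E \<in> carrier_mat N N" by (simp add: E_def)
  ultimately show ?thesis by (simp add: det_mult)
qed

lemma det_sum_into_col:
  fixes g :: "nat \<Rightarrow> nat \<Rightarrow> 'a :: comm_ring_1"
  assumes r: "r < N"
  shows "det (mat N N (\<lambda>(i, j). if j = r then \<Sum>k<N. g i k else g i j)) = det (mat N N (\<lambda>(i, j). g i j))"
proof -
  have T: "det (mat N N (\<lambda>(i, j). h i j)) = det (mat N N (\<lambda>(i, j). h j i))" for h :: "nat \<Rightarrow> nat \<Rightarrow> 'a"
    by (subst det_transpose[symmetric, of _ N]) (auto intro!: arg_cong[where f = det] eq_matI)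
  show ?thesis
    using det_sum_into_row[OF r, of "\<lambda>i j. g j i"] by (subst (1 2) T)
qed

lemma det_subtract_row:
  fixes g :: "nat \<Rightarrow> nat \<Rightarrow> 'a :: comm_ring_1"
  assumes r: "r < N"
  shows "det (mat N N (\<lambda>(i, j). if i = r then g r j else g i j - c * g r j)) = det (mat N N (\<lambda>(i, j). g i j))"
proof -
  define F :: "'a mat" where "F = mat N N (\<lambda>(i, j). (if i = j then 1 else 0) - (if i \<noteq> r \<and> j = r then c else 0))"
  have "det F = F $$ (r, r) * cofactor F r r"
    using r by (intro det_unit_row[of _ N]) (auto simp: F_def)
  also have "cofactor F r r = cofactor (1\<^sub>m N) r r"
    using r by (intro cofactor_diag_cong[of _ N]) (auto simp: F_def)
  finally have "det F = 1" using r by (simp add: cofactor_one F_def)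
  moreover have "mat N N (\<lambda>(i, j). if i = r then g r j else g i j - c * g r j) = F * mat N N (\<lambda>(i, j). g i j)"
    using r by (intro eq_matI)
       (auto simp: F_def scalar_prod_def atLeast0LessThan left_diff_distrib sum_subtractf if_distrib[where f = "\<lambda>x. x * y" for y]
         cong: if_cong)
  moreover have "F \<in> carrier_mat N N" by (simp add: F_def)
  ultimately show ?thesis by (simp add: det_mult)
qed

text \<open>
  When all rows and columns sum to zero, adding all rows to row \<open>r\<close> and then all columns to column \<open>r\<close>
  leaves in row and column \<open>r\<close> only contributions of the added constant \<open>t\<close>: the entry \<open>N\<^sup>2 t\<close> at
  \<open>(r, r)\<close> and \<open>N t\<close> elsewhere. Subtracting multiples of row \<open>r\<close> then removes the constant from all
  other rows. The matrix on the right is the reduced matrix of the matrix-tree theorem, kept at full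
  size by a unit row.
\<close>

lemma det_add_const_zero_sums:
  fixes g :: "nat \<Rightarrow> nat \<Rightarrow> 'a :: field_char_0"
  assumes r: "r < N"
    and rows: "\<And>i. i < N \<Longrightarrow> (\<Sum>j<N. g i j) = 0"
    and cols: "\<And>j. j < N \<Longrightarrow> (\<Sum>i<N. g i j) = 0"
  shows "det (mat N N (\<lambda>(i, j). g i j + t)) =
    t * (of_nat N)\<^sup>2 * det (mat N N (\<lambda>(i, j). if i = r then if j = r then 1 else 0 else g i j))"
    (is "_ = _ * det ?R")
proof -
  \<comment> \<open>the matrix after the row addition, after the column addition, and after the final elimination\<close>
  define h1 where "h1 i j = (if i = r then of_nat N * t else g i j + t)" for i j
  define h2 where "h2 i j = (if j = r then if i = r then (of_nat N)\<^sup>2 * t else of_nat N * t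
    else if i = r then of_nat N * t else g i j + t)" for i j
  define Z where "Z = mat N N (\<lambda>(i, j). if i = r then h2 r j else h2 i j - (1 / of_nat N) * h2 r j)"
  have [simp]: "of_nat N \<noteq> (0 :: 'a)" using r by auto
  have "det (mat N N (\<lambda>(i, j). g i j + t)) = det (mat N N (\<lambda>(i, j). h1 i j))"
    unfolding det_sum_into_row[OF r, of "\<lambda>i j. g i j + t", symmetric]
    by (intro arg_cong[where f = det] eq_matI) (auto simp: h1_def sum.distrib cols)
  also have "\<dots> = det (mat N N (\<lambda>(i, j). h2 i j))"
    unfolding det_sum_into_col[OF r, of "\<lambda>i j. h1 i j", symmetric]
    by (intro arg_cong[where f = det] eq_matI)
       (auto simp: h1_def h2_def sum.distrib rows power2_eq_square)
  also have "\<dots> = det Z"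
    unfolding det_subtract_row[OF r, of h2 "1 / of_nat N", symmetric] Z_def ..
  also have "\<dots> = Z $$ (r, r) * cofactor Z r r"
    using r by (intro det_unit_col[of _ N]) (auto simp: Z_def h2_def power2_eq_square)
  also have "cofactor Z r r = cofactor ?R r r"
    using r by (intro cofactor_diag_cong[of _ N]) (auto simp: Z_def h2_def)
  also have "cofactor ?R r r = det ?R"
    using r by (subst det_unit_row[of ?R N r]) auto
  finally show ?thesis using r by (simp add: Z_def h2_def mult_ac)
qed

text \<open>
  The constant matrix is the Gram matrix of a single column and has rank one, so this is an
  equality case of \<open>det_one_plus_gram\<close>.
\<close>

lemma det_one_plus_const:
  assumes "0 \<le> c"
  shows "det (mat n n (\<lambda>(i, j). (if i = j then 1 else 0) + c)) = 1 + real n * c"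
proof -
  define X where "X = mat n 1 (\<lambda>_. sqrt c)"
  have X: "X \<in> carrier_mat n 1" by (simp add: X_def)
  have G: "X * X\<^sup>T = mat n n (\<lambda>_. c)"
    using assms by (intro eq_matI) (auto simp: X_def scalar_prod_def)
  have "trace_mat (X * X\<^sup>T) = real n * c" by (simp add: G trace_mat_def)
  moreover have "trace_mat (X * X\<^sup>T * (X * X\<^sup>T)) = (real n * c)\<^sup>2"
    by (simp add: G trace_mat_def scalar_prod_def power2_eq_square)
  ultimately have "det (1\<^sub>m n + X * X\<^sup>T) = 1 + real n * c"
    using det_one_plus_gram(2)[OF X] by simp
  moreover have "1\<^sub>m n + X * X\<^sup>T = mat n n (\<lambda>(i, j). (if i = j then 1 else 0) + c)"
    unfolding G by (intro eq_matI) auto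
  ultimately show ?thesis by simp
qed

section \<open>The Laplacian of an orientation of a complete bipartite graph\<close>

text \<open>
  The normalisation makes the trace of this matrix equal to \<open>1\<close> when all \<open>S i j\<close> are signs.
\<close>

definition sign_gram :: "nat \<Rightarrow> nat \<Rightarrow> (nat \<Rightarrow> nat \<Rightarrow> real) \<Rightarrow> real mat" where
  "sign_gram n m S = (let X = mat n m (\<lambda>(i, j). S i j / sqrt (n * m)) in X * X\<^sup>T)"

text \<open>
  The out-degree Laplacian of the orientation of the complete bipartite graph with parts \<open>{..<n}\<close> and
  \<open>{n..<n + m}\<close> in which the edge between \<open>i\<close> and \<open>n + j\<close> points away from \<open>i\<close> iff \<open>S i j = 1\<close>, provided
  that all out-degrees are \<open>m / 2\<close> on the first part and \<open>n / 2\<close> on the second.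
\<close>

definition sign_laplacian :: "nat \<Rightarrow> nat \<Rightarrow> (nat \<Rightarrow> nat \<Rightarrow> real) \<Rightarrow> nat \<Rightarrow> nat \<Rightarrow> real" where
  "sign_laplacian n m S i j =
    (if i < n then if j < n then if i = j then m / 2 else 0 else - (1 + S i (j - n)) / 2
     else if j < n then - (1 - S j (i - n)) / 2 else if i = j then n / 2 else 0)"

lemma sign_gram_carrier: "sign_gram n m S \<in> carrier_mat n n"
  by (auto simp: sign_gram_def Let_def)

lemma sign_gram_index:
  assumes "i < n" "j < n"
  shows "sign_gram n m S $$ (i, j) = (\<Sum>b<m. S i b * S j b) / (n * m)"
  using assms by (simp add: sign_gram_def Let_def scalar_prod_def atLeast0LessThan sum_divide_distrib
    flip: real_sqrt_mult)

context
  fixes n m :: nat and S :: "nat \<Rightarrow> nat \<Rightarrow> real"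
  assumes pos: "0 < n" "0 < m"
    and rows: "\<And>i. i < n \<Longrightarrow> (\<Sum>j<m. S i j) = 0"
    and cols: "\<And>j. j < m \<Longrightarrow> (\<Sum>i<n. S i j) = 0"
begin

text \<open>
  Adding \<open>1 / 2\<close> changes the off-diagonal blocks \<open>- (1 + S) / 2\<close> and \<open>- (1 - S\<^sup>T) / 2\<close> to \<open>- S / 2\<close> and \<open>S\<^sup>T / 2\<close>.
  The lower diagonal block \<open>D\<close>, a multiple of the identity plus a constant, acts on the columns of
  \<open>S\<^sup>T\<close> as the scalar \<open>n / 2\<close>, since these have sum zero. Hence the column operation that clears the
  lower left block is explicit, and the upper left block becomes, up to a scalar, the product of an
  identity plus a constant with \<open>1 + G\<close>.
\<close>

lemma det_sign_laplacian_plus_half: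
  "det (mat (n + m) (n + m) (\<lambda>(i, j). sign_laplacian n m S i j + 1 / 2)) =
    (m / 2) ^ n * (n / 2) ^ m * (1 + n / m) * (1 + m / n) * det (1\<^sub>m n + sign_gram n m S)"
proof -
  note gram = sign_gram_carrier[of n m S]
  let ?\<delta> = "\<lambda>i j :: nat. if i = j then 1 else 0 :: real"
  define A where "A = mat n n (\<lambda>(i, j). m / 2 * ?\<delta> i j + 1 / 2)"
  define B where "B = mat n m (\<lambda>(i, j). - S i j / 2)"
  define C where "C = mat m n (\<lambda>(i, j). S j i / 2)"
  define D where "D = mat m m (\<lambda>(i, j). n / 2 * ?\<delta> i j + 1 / 2)"
  \<comment> \<open>\<open>- D\<inverse> C\<close>, the coefficients of the column operation; \<open>J\<close> is the factor split off from the upper left block\<close>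
  define Y where "Y = mat m n (\<lambda>(i, j). - S j i / n)"
  define J where "J = mat n n (\<lambda>(i, j). ?\<delta> i j + 1 / m)"
  have carr: "A \<in> carrier_mat n n" "B \<in> carrier_mat n m" "C \<in> carrier_mat m n" "D \<in> carrier_mat m m"
    "Y \<in> carrier_mat m n" "J \<in> carrier_mat n n"
    by (auto simp: A_def B_def C_def D_def Y_def J_def)
  \<comment> \<open>multiplication by a multiple of the identity plus a constant matrix\<close>
  have delta_sum: "(\<Sum>k<l. (a * ?\<delta> i k + b) * f k) = a * f i + b * (\<Sum>k<l. f k)"
    if "i < l" for a b i l and f :: "nat \<Rightarrow> real"
  proof -
    have "(\<Sum>k<l. (a * ?\<delta> i k + b) * f k) = (\<Sum>k<l. (if i = k then a * f k else 0) + b * f k)"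
      by (intro sum.cong) (auto simp: algebra_simps)
    then show ?thesis using that by (simp add: sum.distrib sum_distrib_left)
  qed
  have "mat (n + m) (n + m) (\<lambda>(i, j). sign_laplacian n m S i j + 1 / 2) = four_block_mat A B C D"
    by (rule eq_matI) (auto simp: A_def B_def C_def D_def sign_laplacian_def field_simps)
  moreover have "four_block_mat A B C D * four_block_mat (1\<^sub>m n) (0\<^sub>m n m) Y (1\<^sub>m m) =
      four_block_mat (A * 1\<^sub>m n + B * Y) (A * 0\<^sub>m n m + B * 1\<^sub>m m) (C * 1\<^sub>m n + D * Y) (C * 0\<^sub>m n m + D * 1\<^sub>m m)"
    using carr by (intro mult_four_block_mat) auto
  moreover have "C * 1\<^sub>m n + D * Y = 0\<^sub>m m n"
  proof (rule eq_matI)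
    fix i j assume "i < dim_row (0\<^sub>m m n :: real mat)" "j < dim_col (0\<^sub>m m n :: real mat)"
    then have ij: "i < m" "j < n" by auto
    have "(D * Y) $$ (i, j) = (\<Sum>k<m. (n / 2 * ?\<delta> i k + 1 / 2) * (- S j k / n))"
      using ij by (simp add: D_def Y_def scalar_prod_def atLeast0LessThan)
    also have "\<dots> = - S j i / 2"
      unfolding delta_sum[OF ij(1)] using pos rows[OF ij(2)]
      by (simp add: sum_negf flip: sum_divide_distrib)
    finally show "(C * 1\<^sub>m n + D * Y) $$ (i, j) = 0\<^sub>m m n $$ (i, j)"
      using ij carr by (simp add: C_def)
  qed (use carr in auto)
  ultimately have "det (mat (n + m) (n + m) (\<lambda>(i, j). sign_laplacian n m S i j + 1 / 2))
      * det (four_block_mat (1\<^sub>m n) (0\<^sub>m n m) Y (1\<^sub>m m))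
      = det (four_block_mat (A + B * Y) B (0\<^sub>m m n) D)"
    using carr by (simp flip: det_mult[of _ "n + m"])
  then have "det (mat (n + m) (n + m) (\<lambda>(i, j). sign_laplacian n m S i j + 1 / 2)) = det (A + B * Y) * det D"
    using carr by (simp add: det_four_block_mat_upper_right_zero[of _ n _ m]
      det_four_block_mat_lower_left_zero[of _ n _ m])
  moreover have "A + B * Y = (m / 2) \<cdot>\<^sub>m (J * (1\<^sub>m n + sign_gram n m S))"
  proof (rule eq_matI)
    fix i j assume "i < dim_row ((m / 2) \<cdot>\<^sub>m (J * (1\<^sub>m n + sign_gram n m S)))"
      "j < dim_col ((m / 2) \<cdot>\<^sub>m (J * (1\<^sub>m n + sign_gram n m S)))"
    then have ij: "i < n" "j < n" using carr gram by auto
    have "(\<Sum>k<n. \<Sum>b<m. S k b * S j b) = (\<Sum>b<m. (\<Sum>k<n. S k b) * S j b)"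
      by (subst sum.swap) (simp add: sum_distrib_right)
    also have "\<dots> = 0" by (simp add: cols)
    finally have zero: "(\<Sum>k<n. ?\<delta> k j + (\<Sum>b<m. S k b * S j b) / (n * m)) = 1"
      using ij by (simp add: sum.distrib flip: sum_divide_distrib)
    have "(J * (1\<^sub>m n + sign_gram n m S)) $$ (i, j)
        = (\<Sum>k<n. (1 * ?\<delta> i k + 1 / m) * (?\<delta> k j + (\<Sum>b<m. S k b * S j b) / (n * m)))"
      using ij gram by (simp add: J_def scalar_prod_def atLeast0LessThan sign_gram_index)
    also have "\<dots> = ?\<delta> i j + (\<Sum>b<m. S i b * S j b) / (n * m) + 1 / m"
      unfolding delta_sum[OF ij(1)] zero by simp
    finally have "((m / 2) \<cdot>\<^sub>m (J * (1\<^sub>m n + sign_gram n m S))) $$ (i, j)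
        = m / 2 * (?\<delta> i j + (\<Sum>b<m. S i b * S j b) / (n * m) + 1 / m)"
      using ij carr gram by (subst index_smult_mat) auto
    moreover have "(A + B * Y) $$ (i, j) = m / 2 * ?\<delta> i j + 1 / 2 + (\<Sum>b<m. S i b * S j b) / (2 * n)"
      using ij carr by (simp add: A_def B_def Y_def scalar_prod_def atLeast0LessThan sum_divide_distrib)
    ultimately show "(A + B * Y) $$ (i, j) = ((m / 2) \<cdot>\<^sub>m (J * (1\<^sub>m n + sign_gram n m S))) $$ (i, j)"
      using pos by (simp only:) (simp add: field_simps)
  qed (use carr gram in auto)
  moreover have "det J = 1 + n / m"
    using det_one_plus_const[of "1 / m" n] by (simp add: J_def)
  moreover have "det D = (n / 2) ^ m * (1 + m / n)"
  proof -
    have "D = (n / 2) \<cdot>\<^sub>m mat m m (\<lambda>(i, j). ?\<delta> i j + 1 / n)"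
      using pos by (intro eq_matI) (auto simp: D_def field_simps)
    then show ?thesis using det_one_plus_const[of "1 / n" m] by simp
  qed
  ultimately show ?thesis
    using carr gram by (simp add: det_mult[of _ n])
qed

text \<open>
  Rows and columns of the Laplacian sum to zero, so \<open>det_add_const_zero_sums\<close> relates this determinant
  to the one of \<open>det_sign_laplacian_plus_half\<close>. The factors \<open>1 + n / m\<close> and \<open>1 + m / n\<close> cancel against
  \<open>(n + m)\<^sup>2\<close>, at the cost of one factor in each of the two powers. The value does not depend on the root \<open>r\<close>.
\<close>

lemma det_sign_laplacian_reduced:
  assumes r: "r < n + m"
  shows "det (mat (n + m) (n + m) (\<lambda>(i, j). if i = r then if j = r then 1 else 0 else sign_laplacian n m S i j))
    = (m / 2) ^ (n - 1) * (n / 2) ^ (m - 1) * (det (1\<^sub>m n + sign_gram n m S) / 2)" (is "det ?R = _")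
proof -
  have split: "(\<Sum>j<n + m. f j) = (\<Sum>j<n. f j) + (\<Sum>j<m. f (n + j))" for f :: "nat \<Rightarrow> real"
    by (induction m) (auto simp: add.assoc)
  have "(\<Sum>j<n + m. sign_laplacian n m S i j) = 0" if "i < n + m" for i
  proof (cases "i < n")
    case True
    then show ?thesis
      using rows[OF True]
      by (simp add: split sign_laplacian_def sum_subtractf sum_negf sum.distrib flip: sum_divide_distrib)
  next
    case False
    define b where "b = i - n"
    have "i = n + b" "b < m" using False that by (auto simp: b_def)
    then show ?thesis
      using cols[of b]
      by (simp add: split sign_laplacian_def sum_subtractf sum_negf sum.distrib flip: sum_divide_distrib)
  qed
  moreover have "(\<Sum>i<n + m. sign_laplacian n m S i j) = 0" if "j < n + m" for j
  proof (cases "j < n")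
    case True
    then show ?thesis
      using rows[OF True]
      by (simp add: split sign_laplacian_def sum_subtractf sum_negf sum.distrib flip: sum_divide_distrib)
  next
    case False
    define b where "b = j - n"
    have "j = n + b" "b < m" using False that by (auto simp: b_def)
    then show ?thesis
      using cols[of b]
      by (simp add: split sign_laplacian_def sum_subtractf sum_negf sum.distrib flip: sum_divide_distrib)
  qed
  ultimately have "1 / 2 * (real (n + m))\<^sup>2 * det ?R
      = (m / 2) ^ n * (n / 2) ^ m * (1 + n / m) * (1 + m / n) * det (1\<^sub>m n + sign_gram n m S)"
    using det_add_const_zero_sums[OF r, of "sign_laplacian n m S" "1 / 2"] det_sign_laplacian_plus_half
    by (simp only:)
  moreover have "(m / 2) ^ n * (n / 2) ^ m * (1 + n / m) * (1 + m / n)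
      = (m / 2) ^ (n - 1) * (n / 2) ^ (m - 1) * ((real (n + m))\<^sup>2 / 4)"
  proof -
    have powers: "(m / 2) ^ n = (m / 2) * (m / 2) ^ (n - 1)" "(n / 2) ^ m = (n / 2) * (n / 2) ^ (m - 1)"
      using pos by (simp_all add: power_eq_if)
    have factors: "m / 2 * (n / 2) * (1 + n / m) * (1 + m / n) = (real (n + m))\<^sup>2 / 4"
      using pos by (simp add: field_simps power2_eq_square)
    show ?thesis unfolding powers factors[symmetric] by (simp only: mult_ac)
  qed
  ultimately have eq: "1 / 2 * (real (n + m))\<^sup>2 * det ?R
      = (m / 2) ^ (n - 1) * (n / 2) ^ (m - 1) * ((real (n + m))\<^sup>2 / 4) * det (1\<^sub>m n + sign_gram n m S)"
    by (simp only:)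
  have cancel: "x = c * (y / 2)" if "1 / 2 * q * x = c * (q / 4) * y" "q \<noteq> 0" for c q x y :: real
    using that by (simp add: field_simps)
  show ?thesis by (rule cancel[OF eq]) (use pos in simp)
qed

end

section \<open>The matrix-tree theorem\<close>

text \<open>
  A choice of one out-arc at every vertex other than the root, as a relation. It is an arborescence
  iff every vertex reaches the root along it.
\<close>

definition choice_arcs :: "'a set \<Rightarrow> 'a \<Rightarrow> ('a \<Rightarrow> 'a) \<Rightarrow> ('a \<times> 'a) set" where
  "choice_arcs V r g = {(u, g u) | u. u \<in> V - {r}}"

lemma in_choice_arcs: "(u, w) \<in> choice_arcs V r g \<longleftrightarrow> u \<in> V \<and> u \<noteq> r \<and> w = g u"
  by (auto simp: choice_arcs_def)

lemma choice_fixpoint_not_reaching: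
  assumes "g u = u" "(u, r) \<in> (choice_arcs V r g)\<^sup>*"
  shows "u = r"
proof -
  have "w = u" if "(u, w) \<in> (choice_arcs V r g)\<^sup>*" for w
    using that by (induction rule: rtrancl_induct) (auto simp: in_choice_arcs assms(1))
  then show ?thesis using assms(2) by blast
qed

context
  fixes v :: "nat \<Rightarrow> 'a" and V :: "'a set" and N :: nat and r :: 'a
  assumes bij: "bij_betw v {..<N} V" and r: "r \<in> V"
begin

lemma enum_in: "i < N \<Longrightarrow> v i \<in> V"
  using bij by (auto simp: bij_betw_def)

lemma enum_inj: "i < N \<Longrightarrow> j < N \<Longrightarrow> v i = v j \<longleftrightarrow> i = j"
  using bij by (auto simp: bij_betw_def inj_on_def)

lemma enum_surj: "u \<in> V \<Longrightarrow> \<exists>i<N. v i = u"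
  using bij by (auto simp: bij_betw_def)

text \<open>
  If every vertex reaches the root, a permutation contributing to the Leibniz formula fixes the root
  and, going backwards along the arcs, every other vertex, since its image could otherwise only be
  a vertex already known to be fixed. So only the identity contributes. If some vertex does not reach
  the root, the indicator of these vertices is constant along arcs and zero at the root, hence a
  nonzero vector in the kernel.
\<close>

lemma det_choice_matrix:
  fixes g :: "'a \<Rightarrow> 'a"
  assumes g: "\<And>u. u \<in> V - {r} \<Longrightarrow> g u \<in> V"
  defines "M \<equiv> \<lambda>u w. if u = r then of_bool (w = r) else of_bool (w = u) - of_bool (w = g u) :: real"
  shows "det (mat N N (\<lambda>(i, j). M (v i) (v j))) =
    of_bool (\<forall>u \<in> V. (u, r) \<in> (choice_arcs V r g)\<^sup>*)"
proof (cases "\<forall>u \<in> V. (u, r) \<in> (choice_arcs V r g)\<^sup>*")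
  case reach: True
  have perm: "p = id" if p: "p permutes {0..<N}" and nz: "\<And>i. i < N \<Longrightarrow> M (v i) (v (p i)) \<noteq> 0" for p
  proof -
    have p_less: "p i < N" if "i < N" for i
      using permutes_in_image[OF p, of i] that by simp
    have fixed: "\<forall>i<N. v i = u \<longrightarrow> p i = i" if "(u, r) \<in> (choice_arcs V r g)\<^sup>*" for u
      using that
    proof (induction rule: converse_rtrancl_induct)
      case base
      show ?case
      proof (intro allI impI)
        fix i assume i: "i < N" "v i = r"
        then have "v (p i) = r" using nz[OF i(1)] by (auto simp: M_def)
        then show "p i = i" using i enum_inj[OF p_less[OF i(1)] i(1)] by simp
      qed
    next
      case (step u w)
      show ?case
      proof (intro allI impI)
        fix i assume i: "i < N" "v i = u"
        have "v (p i) = u \<or> v (p i) = w"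
          using nz[OF i(1)] step(1) i by (auto simp: M_def in_choice_arcs split: if_splits)
        then show "p i = i"
        proof
          assume "v (p i) = u"
          then show ?thesis using i enum_inj[OF p_less[OF i(1)] i(1)] by simp
        next
          assume "v (p i) = w"
          then have "p (p i) = p i" using step(3) p_less[OF i(1)] by blast
          then show ?thesis using permutes_inj[OF p] by (simp add: inj_eq)
        qed
      qed
    qed
    show ?thesis
    proof
      fix i
      show "p i = id i"
        using fixed[of "v i"] reach enum_in permutes_not_in[OF p, of i] by (cases "i < N") auto
    qed
  qed
  have "det (mat N N (\<lambda>(i, j). M (v i) (v j)))
      = (\<Sum>p \<in> {p. p permutes {0..<N}}. signof p * (\<Prod>i = 0..<N. M (v i) (v (p i))))"
    by (subst det_def'[of _ N]) (auto intro!: sum.cong prod.cong dest: permutes_in_image)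
  also have "\<dots> = (\<Sum>p \<in> {id}. signof p * (\<Prod>i = 0..<N. M (v i) (v (p i))))"
    using perm by (intro sum.mono_neutral_right) (auto simp: finite_permutations permutes_id)
  also have "\<dots> = (\<Prod>i = 0..<N. M (v i) (v i))"
    by simp
  also have "\<dots> = 1"
  proof (intro prod.neutral ballI)
    fix i assume "i \<in> {0..<N}"
    then have "v i \<in> V" using enum_in by simp
    then have "(v i, r) \<in> (choice_arcs V r g)\<^sup>*" using reach by blast
    then have "v i = r \<or> g (v i) \<noteq> v i" using choice_fixpoint_not_reaching by metis
    then show "M (v i) (v i) = 1" unfolding M_def by auto
  qed
  finally show ?thesis using reach by simp
next
  case False
  then obtain u0 where u0: "u0 \<in> V" "(u0, r) \<notin> (choice_arcs V r g)\<^sup>*" by blast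
  define X :: "'a \<Rightarrow> real" where "X u = of_bool ((u, r) \<notin> (choice_arcs V r g)\<^sup>*)" for u
  define x where "x = vec N (\<lambda>i. X (v i))"
  have fin: "finite V" using bij by (metis bij_betw_finite finite_lessThan)
  have X_step: "X u = X (g u)" if "u \<in> V - {r}" for u
  proof -
    have "(u, r) \<in> (choice_arcs V r g)\<^sup>* \<longleftrightarrow> (g u, r) \<in> (choice_arcs V r g)\<^sup>*"
      using that by (auto simp: in_choice_arcs elim: converse_rtranclE intro: converse_rtrancl_into_rtrancl)
    then show ?thesis by (simp add: X_def)
  qed
  have "mat N N (\<lambda>(i, j). M (v i) (v j)) *\<^sub>v x = 0\<^sub>v N"
  proof (rule eq_vecI)
    fix i assume "i < dim_vec (0\<^sub>v N :: real vec)"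
    then have i: "i < N" by simp
    then have "(mat N N (\<lambda>(i, j). M (v i) (v j)) *\<^sub>v x) $ i = (\<Sum>j<N. M (v i) (v j) * X (v j))"
      by (simp add: x_def scalar_prod_def atLeast0LessThan)
    also have "\<dots> = (\<Sum>w \<in> V. M (v i) w * X w)"
      by (rule sum.reindex_bij_betw[OF bij, of "\<lambda>w. M (v i) w * X w"])
    also have "\<dots> = 0"
    proof (cases "v i = r")
      case True
      then show ?thesis using fin r by (simp add: M_def X_def of_bool_def)
    next
      case False
      then have "(\<Sum>w \<in> V. M (v i) w * X w) = (\<Sum>w \<in> V. of_bool (w = v i) * X w) - (\<Sum>w \<in> V. of_bool (w = g (v i)) * X w)"
        by (simp add: M_def left_diff_distrib sum_subtractf)
      also have "\<dots> = X (v i) - X (g (v i))"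
        using fin enum_in[OF i] g[of "v i"] False by (simp add: of_bool_def if_distrib[where f = "\<lambda>x. x * y" for y] cong: if_cong)
      finally show ?thesis using X_step enum_in[OF i] False by simp
    qed
    finally show "(mat N N (\<lambda>(i, j). M (v i) (v j)) *\<^sub>v x) $ i = 0\<^sub>v N $ i" using i by simp
  qed simp
  moreover have "x \<noteq> 0\<^sub>v N"
  proof -
    obtain i where "i < N" "v i = u0" using enum_surj[OF u0(1)] by blast
    then have "x $ i = 1" using u0(2) by (simp add: x_def X_def)
    then show ?thesis using \<open>i < N\<close> by auto
  qed
  ultimately have "det (mat N N (\<lambda>(i, j). M (v i) (v j))) = 0"
    by (subst det_0_iff_vec_prod_zero[of _ N]) (auto simp: x_def intro!: exI[of _ x])
  then show ?thesis using False by simp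
qed

text \<open>
  The matrix-tree theorem. Row \<open>u\<close> of the Laplacian is the sum over the out-neighbours \<open>k\<close> of \<open>u\<close> of the
  rows \<open>e\<^sub>u - e\<^sub>k\<close>. By multilinearity the determinant is the sum of the determinants of all choice
  matrices, each of which is \<open>1\<close> for an arborescence and \<open>0\<close> otherwise.
\<close>

theorem matrix_tree_choices:
  fixes out :: "'a \<Rightarrow> 'a set"
  assumes out: "\<And>u. u \<in> V \<Longrightarrow> out u \<subseteq> V"
  shows "det (mat N N (\<lambda>(i, j). if v i = r then of_bool (v j = r)
      else real (card (out (v i))) * of_bool (i = j) - of_bool (v j \<in> out (v i)))) =
    card {g \<in> Pi\<^sub>E (V - {r}) out. \<forall>u \<in> V. (u, r) \<in> (choice_arcs V r g)\<^sup>*}"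
    (is "det ?L = _")
proof -
  define M :: "('a \<Rightarrow> 'a) \<Rightarrow> 'a \<Rightarrow> 'a \<Rightarrow> real"
    where "M g u w = (if u = r then of_bool (w = r) else of_bool (w = u) - of_bool (w = g u))" for g u w
  have fin: "finite V" using bij by (metis bij_betw_finite finite_lessThan)
  have fin_out: "finite (out u)" if "u \<in> V" for u using out[OF that] fin by (rule finite_subset)
  have split: "(\<Prod>i = 0..<N. h i) = h i0 * (\<Prod>i \<in> {..<N} - {i0}. h i)" if "i0 < N" for h :: "nat \<Rightarrow> real" and i0
    using that by (subst prod.remove[of _ i0]) (auto simp: atLeast0LessThan)
  obtain i0 where i0: "i0 < N" "v i0 = r" using enum_surj[OF r] by blast
  have bij0: "bij_betw v ({..<N} - {i0}) (V - {r})"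
    using bij i0 by (auto simp: bij_betw_def inj_on_def)
  have expand: "(\<Prod>i = 0..<N. ?L $$ (i, p i)) = (\<Sum>g \<in> Pi\<^sub>E (V - {r}) out. \<Prod>i = 0..<N. M g (v i) (v (p i)))"
    if p: "p permutes {0..<N}" for p
  proof -
    \<comment> \<open>the permutation \<open>p\<close> of the indices, moved to the vertices\<close>
    define q where "q u = v (p (inv_into {..<N} v u))" for u
    have p_less: "p i < N" if "i < N" for i
      using permutes_in_image[OF p, of i] that by simp
    have q: "q (v i) = v (p i)" if "i < N" for i
      using that bij by (simp add: q_def bij_betw_def)
    have "(\<Prod>i = 0..<N. ?L $$ (i, p i))
        = of_bool (v (p i0) = r) * (\<Prod>i \<in> {..<N} - {i0}. ?L $$ (i, p i))"
      using i0 p_less by (subst split[OF i0(1)]) simp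
    also have "(\<Prod>i \<in> {..<N} - {i0}. ?L $$ (i, p i))
        = (\<Prod>i \<in> {..<N} - {i0}. \<Sum>k \<in> out (v i). of_bool (q (v i) = v i) - of_bool (q (v i) = k))"
    proof (rule prod.cong[OF refl])
      fix i assume i: "i \<in> {..<N} - {i0}"
      then have "v i \<noteq> r" "v i \<in> V" using i0 enum_inj enum_in by auto
      then show "?L $$ (i, p i) = (\<Sum>k \<in> out (v i). of_bool (q (v i) = v i) - of_bool (q (v i) = k))"
        using i p_less fin_out enum_inj[of "p i" i]
        by (auto simp: q sum_subtractf of_bool_def)
    qed
    also have "\<dots> = (\<Prod>u \<in> V - {r}. \<Sum>k \<in> out u. of_bool (q u = u) - of_bool (q u = k))"
      by (rule prod.reindex_bij_betw[OF bij0])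
    also have "\<dots> = (\<Sum>g \<in> Pi\<^sub>E (V - {r}) out. \<Prod>u \<in> V - {r}. of_bool (q u = u) - of_bool (q u = g u))"
      using fin fin_out by (intro prod_sum_PiE) auto
    also have "\<dots> = (\<Sum>g \<in> Pi\<^sub>E (V - {r}) out. \<Prod>i \<in> {..<N} - {i0}. M g (v i) (v (p i)))"
    proof (rule sum.cong[OF refl])
      fix g
      have "(\<Prod>u \<in> V - {r}. of_bool (q u = u) - of_bool (q u = g u) :: real)
          = (\<Prod>i \<in> {..<N} - {i0}. of_bool (q (v i) = v i) - of_bool (q (v i) = g (v i)))"
        by (rule prod.reindex_bij_betw[OF bij0, symmetric])
      also have "\<dots> = (\<Prod>i \<in> {..<N} - {i0}. M g (v i) (v (p i)))"
        using i0 enum_inj by (intro prod.cong) (auto simp: M_def q)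
      finally show "(\<Prod>u \<in> V - {r}. of_bool (q u = u) - of_bool (q u = g u) :: real) = \<dots>" .
    qed
    finally show ?thesis
      using i0 by (simp add: split[OF i0(1)] M_def sum_distrib_left)
  qed
  have "det ?L = (\<Sum>p \<in> {p. p permutes {0..<N}}. signof p * (\<Prod>i = 0..<N. ?L $$ (i, p i)))"
    by (rule det_def') simp
  also have "\<dots> = (\<Sum>p \<in> {p. p permutes {0..<N}}. \<Sum>g \<in> Pi\<^sub>E (V - {r}) out.
      signof p * (\<Prod>i = 0..<N. M g (v i) (v (p i))))"
    by (intro sum.cong refl) (simp only: mem_Collect_eq expand sum_distrib_left)
  also have "\<dots> = (\<Sum>g \<in> Pi\<^sub>E (V - {r}) out. det (mat N N (\<lambda>(i, j). M g (v i) (v j))))"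
    by (subst sum.swap, intro sum.cong refl, subst det_def'[of _ N])
       (auto intro!: sum.cong prod.cong dest: permutes_in_image)
  also have "\<dots> = (\<Sum>g \<in> Pi\<^sub>E (V - {r}) out. of_bool (\<forall>u \<in> V. (u, r) \<in> (choice_arcs V r g)\<^sup>*))"
    unfolding M_def using out by (intro sum.cong refl det_choice_matrix) (auto dest: PiE_mem)
  also have "\<dots> = card {g \<in> Pi\<^sub>E (V - {r}) out. \<forall>u \<in> V. (u, r) \<in> (choice_arcs V r g)\<^sup>*}"
    using fin fin_out by (subst sum_of_bool_eq) (auto intro!: finite_PiE simp: Int_def)
  finally show ?thesis .
qed

end

section \<open>Arborescences as choices of out-arcs\<close>

lemma pcas_nth:
  assumes "pcas u p v" "p \<noteq> []"
  shows "fst (p ! 0) = u" "snd (p ! (length p - 1)) = v" "pawalk_verts u p = u # map snd p"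
    and "\<And>i. Suc i < length p \<Longrightarrow> fst (p ! Suc i) = snd (p ! i)"
  using assms
proof (induction p arbitrary: u)
  case (Cons e p)
  {
    case 1 then show ?case using Cons by simp
  next
    case 2 then show ?case using Cons.IH(2)[of "snd e"] by (cases p) auto
  next
    case 3 then show ?case using Cons.IH(3)[of "snd e"] by (cases p) auto
  next
    case (4 i) then show ?case using Cons.IH(1)[of "snd e"] Cons.IH(4)[where u = "snd e"] by (cases p; cases i) auto
  }
qed auto

text \<open>
  On a cycle of the underlying undirected graph, acyclicity of \<open>F\<close> gives a vertex with no incoming arc
  of \<open>F\<close> from the cycle. Both cycle edges at this vertex then leave it, so uniqueness of out-arcs forces
  its two neighbours on the cycle to coincide, which they cannot do on a cycle of length at least 3.
\<close>

lemma no_undirected_cycle: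
  assumes "finite F" "acyclic F" and unique: "\<And>u w w'. (u, w) \<in> F \<Longrightarrow> (u, w') \<in> F \<Longrightarrow> w = w'"
    and "pcas u p u" "distinct (tl (pawalk_verts u p))" "set p \<subseteq> F \<union> F\<inverse>"
  shows "length p < 3"
proof (rule ccontr)
  assume "\<not> length p < 3"
  then have k: "3 \<le> length p" and "p \<noteq> []" by auto
  note nth = pcas_nth[OF assms(4) \<open>p \<noteq> []\<close>]
  have dist: "distinct (map snd p)" using assms(5) nth(3) by simp
  define prv where "prv i = (if i = 0 then length p - 1 else i - 1)" for i
  define nxt where "nxt i = (if Suc i = length p then 0 else Suc i)" for i
  have link: "fst (p ! i) = snd (p ! prv i)" if "i < length p" for i
    using nth that by (cases i) (auto simp: prv_def)
  have wf: "wf F" using assms(1,2) by (rule finite_acyclic_wf)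
  have "snd (p ! 0) \<in> set (map snd p)" using \<open>p \<noteq> []\<close> by auto
  then obtain x where x: "x \<in> set (map snd p)" "\<And>y. (y, x) \<in> F \<Longrightarrow> y \<notin> set (map snd p)"
    using wfE_min[OF wf] by metis
  then obtain i where i: "i < length p" "x = snd (p ! i)"
    by (auto simp: in_set_conv_nth)
  have idx: "prv i < length p" "nxt i < length p" "prv (nxt i) = i" "prv i \<noteq> nxt i"
    using i(1) k by (auto simp: prv_def nxt_def)
  have in_cyc: "snd (p ! j) \<in> set (map snd p)" if "j < length p" for j
    using that by auto
  have sym: "p ! j \<in> F \<or> (snd (p ! j), fst (p ! j)) \<in> F" if "j < length p" for j
    using assms(6) nth_mem[OF that] by (cases "p ! j") auto
  have "(x, snd (p ! prv i)) \<in> F"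
    using sym[OF i(1)] x(2) in_cyc[OF idx(1)] link[OF i(1)] i(2) by (metis prod.collapse)
  moreover have "(x, snd (p ! nxt i)) \<in> F"
    using sym[OF idx(2)] x(2) in_cyc[OF idx(2)] link[OF idx(2)] i(2) idx(3) by (metis prod.collapse)
  ultimately have "snd (p ! prv i) = snd (p ! nxt i)" by (rule unique)
  then show False
    using dist idx by (auto simp: distinct_conv_nth)
qed

text \<open>
  Out-arcs are unique, so a vertex on a directed cycle never leaves it; but the root, having no
  out-arc, lies on none.
\<close>

lemma acyclic_if_reaching:
  assumes unique: "\<And>u w w'. (u, w) \<in> F \<Longrightarrow> (u, w') \<in> F \<Longrightarrow> w = w'"
    and root: "\<And>w. (r, w) \<notin> F" and "\<And>u w. (u, w) \<in> F \<Longrightarrow> (u, r) \<in> F\<^sup>*"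
  shows "acyclic F"
proof -
  have "(u, u) \<notin> F\<^sup>+" if "(u, r) \<in> F\<^sup>*" for u
    using that
  proof (induction rule: converse_rtrancl_induct)
    case base
    show ?case using root by (meson tranclD)
  next
    case (step y z)
    show ?case
    proof
      assume "(y, y) \<in> F\<^sup>+"
      then obtain z' where "(y, z') \<in> F" "(z', y) \<in> F\<^sup>*" by (meson tranclD)
      then have "(z, z) \<in> F\<^sup>+" using unique step(1) by (metis rtrancl_into_trancl1)
      then show False using step.IH by blast
    qed
  qed
  moreover have "(u, r) \<in> F\<^sup>*" if "(u, u) \<in> F\<^sup>+" for u
    using that assms(3) by (meson tranclD)
  ultimately show ?thesis by (auto simp: acyclic_def)
qed

definition out_nbrs :: "'a pair_pre_digraph \<Rightarrow> 'a \<Rightarrow> 'a set" where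
  "out_nbrs D u = {w. (u, w) \<in> parcs D}"

definition root_choices :: "'a pair_pre_digraph \<Rightarrow> 'a \<Rightarrow> ('a \<Rightarrow> 'a) set" where
  "root_choices D r = {g \<in> Pi\<^sub>E (pverts D - {r}) (out_nbrs D).
     \<forall>u \<in> pverts D. (u, r) \<in> (choice_arcs (pverts D) r g)\<^sup>*}"

context
  fixes D :: "'a pair_pre_digraph" and r :: 'a
  assumes fin: "finite (pverts D)" and wf: "parcs D \<subseteq> pverts D \<times> pverts D" and r: "r \<in> pverts D"
begin

lemma wf_D: "wf_digraph (with_proj D)"
  using wf by unfold_locales auto

text \<open>
  Reaching the root from everywhere gives connectedness, and with uniqueness of out-arcs it excludes
  both directed and undirected cycles.
\<close>

lemma choice_imp_arborescence:
  assumes g: "g \<in> root_choices D r"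
  shows "arborescence D r \<lparr>pverts = pverts D, parcs = choice_arcs (pverts D) r g\<rparr>"
proof -
  define F where "F = choice_arcs (pverts D) r g"
  define T where "T = \<lparr>pverts = pverts D, parcs = F\<rparr>"
  define S where "S = with_proj (mk_symmetric (with_proj T))"
  have F: "(u, w) \<in> F \<longleftrightarrow> u \<in> pverts D \<and> u \<noteq> r \<and> w = g u" for u w
    by (simp add: F_def in_choice_arcs)
  have FD: "F \<subseteq> parcs D" using g by (auto simp: F root_choices_def out_nbrs_def PiE_iff)
  then have FV: "F \<subseteq> pverts D \<times> pverts D" using wf by auto
  have finF: "finite F" using FV fin by (meson finite_SigmaI finite_subset)
  have reach: "(u, r) \<in> F\<^sup>*" if "u \<in> pverts D" for u
    using g that by (auto simp: root_choices_def F_def)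
  have acyc: "acyclic F" by (rule acyclic_if_reaching[of _ r]) (auto simp: F reach)
  have wf_T: "wf_digraph (with_proj T)" using FV by unfold_locales (auto simp: T_def)
  have arcs_S: "arcs S = F \<union> F\<inverse>" "verts S = pverts D" "arcs_ends S = F \<union> F\<inverse>"
    by (auto simp: S_def T_def parcs_mk_symmetric)
  have "(u, r) \<in> rtrancl_on (pverts D) (F \<union> F\<inverse>) \<and> (r, u) \<in> rtrancl_on (pverts D) (F \<union> F\<inverse>)"
    if "u \<in> pverts D" for u
    using reach[OF that]
  proof (induction rule: converse_rtrancl_induct)
    case base
    then show ?case using r by simp
  next
    case (step y z)
    then have "y \<in> pverts D" "z \<in> pverts D" using FV by auto
    with step show ?case
      by (auto intro: converse_rtrancl_on_into_rtrancl_on rtrancl_on_into_rtrancl_on)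
  qed
  then have "strongly_connected S"
    using r unfolding strongly_connected_def reachable_def arcs_S by (auto intro: rtrancl_on_trans)
  then have conn: "connected (with_proj T)" by (simp add: connected_def S_def)
  have "\<not> pre_digraph.cycle (with_proj T) p" for p
  proof
    assume "pre_digraph.cycle (with_proj T) p"
    then obtain u where p: "set p \<subseteq> F" "pcas u p u" "p \<noteq> []"
      by (auto simp: pre_digraph.cycle_def pre_digraph.awalk_def cas_with_proj_eq awalk_verts_with_proj_eq T_def)
    have "(u, w) \<in> F\<^sup>+" if "set p \<subseteq> F" "pcas u p w" "p \<noteq> []" for u w p
      using that
    proof (induction p arbitrary: u)
      case (Cons e p)
      then have "(fst e, snd e) \<in> F" "u = fst e" by auto
      with Cons show ?case
        using trancl_into_trancl2[of "fst e" "snd e" F w] by (cases "p = []") auto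
    qed simp
    from this[OF p] show False using acyc by (auto simp: acyclic_def)
  qed
  then have "forest (with_proj T)" by (simp add: forest_def)
  moreover have "spanning (with_proj T) (with_proj D)"
    using wf_D wf_T FD by (auto simp: spanning_def subgraph_def compatible_def T_def)
  moreover have "\<not> (\<exists>p. pre_digraph.cycle S p \<and> 3 \<le> length p)"
  proof (intro notI, elim exE conjE)
    fix p assume "pre_digraph.cycle S p" and k: "3 \<le> length p"
    then obtain u where "set p \<subseteq> F \<union> F\<inverse>" "pcas u p u" "distinct (tl (pawalk_verts u p))"
      using arcs_S unfolding S_def by (auto simp: pre_digraph.cycle_def pre_digraph.awalk_def cas_with_proj_eq awalk_verts_with_proj_eq)
    then have "length p < 3"
      by (intro no_undirected_cycle[OF finF acyc]) (auto simp: F)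
    then show False using k by simp
  qed
  ultimately have "undirected_spanning_tree T D"
    using conn by (auto simp: undirected_spanning_tree_def spanning_tree_def tree_def S_def)
  moreover have "out_arcs (with_proj T) u = (if u \<in> pverts D - {r} then {(u, g u)} else {})" for u
    by (auto simp: out_arcs_def T_def F)
  ultimately have "arborescence D r T"
    using r by (auto simp: arborescence_def out_degree_def T_def)
  then show ?thesis by (simp add: T_def F_def)
qed

text \<open>
  The degree conditions make the arcs of \<open>T\<close> a choice of out-arcs. That every vertex reaches the root
  comes from connectedness: the set of vertices reaching the root is closed under traversing
  arcs in either direction, because a vertex with an arc into \<open>y\<close> reaches the root through \<open>y\<close>, and the
  head of the only out-arc of \<open>y\<close> is the next vertex on the way from \<open>y\<close> to the root.
\<close>

lemma arborescence_imp_choice: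
  assumes T: "arborescence D r T"
  shows "\<exists>g \<in> root_choices D r. T = \<lparr>pverts = pverts D, parcs = choice_arcs (pverts D) r g\<rparr>"
proof -
  define F where "F = parcs T"
  have tree: "spanning_tree (with_proj T) (with_proj D)"
    and deg: "\<And>u. u \<in> pverts T \<Longrightarrow> u \<noteq> r \<Longrightarrow> out_degree (with_proj T) u = 1"
    and deg_r: "out_degree (with_proj T) r = 0"
    using T by (auto simp: arborescence_def undirected_spanning_tree_def)
  have V: "pverts T = pverts D" and FD: "F \<subseteq> parcs D"
    using tree by (auto simp: spanning_tree_def spanning_def subgraph_def F_def)
  have FV: "F \<subseteq> pverts D \<times> pverts D" using FD wf by auto
  have finF: "finite F" using FV fin by (meson finite_SigmaI finite_subset)
  have root: "(r, w) \<notin> F" for w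
    using deg_r finF by (auto simp: out_degree_def out_arcs_def F_def)
  have "\<exists>w. {e \<in> F. fst e = u} = {(u, w)}" if "u \<in> pverts D" "u \<noteq> r" for u
  proof -
    have "card {e \<in> F. fst e = u} = 1"
      using deg[of u] that V by (simp add: out_degree_def out_arcs_def F_def)
    then obtain e where e: "{e \<in> F. fst e = u} = {e}" by (auto simp: card_1_singleton_iff)
    then have "fst e = u" by blast
    then show ?thesis using e by (metis prod.collapse)
  qed
  then obtain g where g: "\<And>u. u \<in> pverts D \<Longrightarrow> u \<noteq> r \<Longrightarrow> {e \<in> F. fst e = u} = {(u, g u)}"
    by metis
  define g' where "g' = restrict g (pverts D - {r})"
  have F: "F = choice_arcs (pverts D) r g'"
  proof (rule equalityI; rule subsetI)
    fix e assume e: "e \<in> F"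
    then have "fst e \<in> pverts D" "fst e \<noteq> r" using FV root by (cases e, auto)+
    moreover have "e \<in> {e' \<in> F. fst e' = fst e}" using e by simp
    ultimately show "e \<in> choice_arcs (pverts D) r g'"
      using g by (auto simp: choice_arcs_def g'_def)
  next
    fix e assume "e \<in> choice_arcs (pverts D) r g'"
    then obtain u where "u \<in> pverts D" "u \<noteq> r" "e = (u, g u)"
      by (auto simp: choice_arcs_def g'_def)
    then show "e \<in> F" using g by blast
  qed
  have "(u, r) \<in> F\<^sup>*" if "u \<in> pverts D" for u
  proof -
    have "(u, r) \<in> rtrancl_on (pverts D) (F \<union> F\<inverse>)"
    proof -
      have "connected (with_proj T)" using tree by (simp add: spanning_tree_def tree_def)
      moreover have "parcs (mk_symmetric (with_proj T)) = F \<union> F\<inverse>"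
        by (auto simp: parcs_mk_symmetric F_def)
      ultimately show ?thesis
        using that r V by (simp add: connected_def strongly_connected_def reachable_def)
    qed
    then show ?thesis
    proof (induction rule: converse_rtrancl_on_induct)
      case base
      show ?case by simp
    next
      case (step x y)
      show ?case
      proof (cases "(x, y) \<in> F")
        case True
        then show ?thesis using step by (auto intro: converse_rtrancl_into_rtrancl)
      next
        case False
        then have yx: "(y, x) \<in> F" using step by auto
        then have "y \<noteq> r" using root by auto
        then obtain z where "(y, z) \<in> F" "(z, r) \<in> F\<^sup>*"
          using step by (metis converse_rtranclE)
        then show ?thesis using yx by (auto simp: F in_choice_arcs)
      qed
    qed
  qed
  moreover have "g' \<in> Pi\<^sub>E (pverts D - {r}) (out_nbrs D)"
    using FD by (auto simp: g'_def F in_choice_arcs out_nbrs_def PiE_iff subset_iff)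
  ultimately have "g' \<in> root_choices D r" by (simp add: root_choices_def F)
  moreover have "T = \<lparr>pverts = pverts D, parcs = choice_arcs (pverts D) r g'\<rparr>"
    using V F by (simp add: F_def)
  ultimately show ?thesis by blast
qed

lemma arb_eq_card_root_choices: "arb D r = card (root_choices D r)"
proof -
  let ?T = "\<lambda>g. \<lparr>pverts = pverts D, parcs = choice_arcs (pverts D) r g\<rparr>"
  have "{T. arborescence D r T} = ?T ` root_choices D r"
    using choice_imp_arborescence arborescence_imp_choice by blast
  moreover have "inj_on ?T (root_choices D r)"
  proof (rule inj_onI)
    fix g h assume gh: "g \<in> root_choices D r" "h \<in> root_choices D r" "?T g = ?T h"
    then have eq: "(u, w) \<in> choice_arcs (pverts D) r g \<longleftrightarrow> (u, w) \<in> choice_arcs (pverts D) r h" for u w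
      by simp
    have "g u = h u" if "u \<in> pverts D - {r}" for u
      using eq[of u "g u"] that by (simp add: in_choice_arcs)
    moreover have "g \<in> extensional (pverts D - {r})" "h \<in> extensional (pverts D - {r})"
      using gh by (auto simp: root_choices_def PiE_iff)
    ultimately show "g = h" by (intro extensionalityI)
  qed
  ultimately show ?thesis by (simp add: arb_def card_image)
qed

end

section \<open>Eulerian orientations of complete bipartite graphs\<close>

text \<open>
  Cauchy-Schwarz for sign vectors. The equality case is the vanishing of one of the sums of
  nonnegative terms \<open>1 - s b * t b\<close> and \<open>1 + s b * t b\<close>.
\<close>

lemma sign_scalar_prod:
  fixes s t :: "'b \<Rightarrow> real"
  assumes fin: "finite B" and s: "\<And>b. b \<in> B \<Longrightarrow> s b \<in> {-1, 1}" and t: "\<And>b. b \<in> B \<Longrightarrow> t b \<in> {-1, 1}"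
  shows "(\<Sum>b\<in>B. s b * t b)\<^sup>2 \<le> (real (card B))\<^sup>2"
    and "(\<Sum>b\<in>B. s b * t b)\<^sup>2 = (real (card B))\<^sup>2 \<longleftrightarrow> (\<forall>b\<in>B. s b = t b) \<or> (\<forall>b\<in>B. s b = - t b)"
proof -
  define x where "x = (\<Sum>b\<in>B. s b * t b)"
  have prod: "s b * t b = 1 \<and> s b = t b \<and> s b \<noteq> - t b \<or> s b * t b = -1 \<and> s b = - t b \<and> s b \<noteq> t b"
    if "b \<in> B" for b
    using s[OF that] t[OF that] by auto
  have minus: "card B - x = (\<Sum>b\<in>B. 1 - s b * t b)" and plus: "card B + x = (\<Sum>b\<in>B. 1 + s b * t b)"
    by (simp_all add: x_def sum_subtractf sum.distrib)
  have nonneg: "0 \<le> 1 - s b * t b" "0 \<le> 1 + s b * t b" if "b \<in> B" for b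
    using prod[OF that] by auto
  have "0 \<le> card B - x" "0 \<le> card B + x"
    unfolding minus plus by (intro sum_nonneg nonneg; assumption)+
  then have "\<bar>x\<bar> \<le> \<bar>real (card B)\<bar>" by simp
  then show "x\<^sup>2 \<le> (real (card B))\<^sup>2" by (simp only: abs_le_square_iff)
  have "x\<^sup>2 = (real (card B))\<^sup>2 \<longleftrightarrow> card B - x = 0 \<or> card B + x = 0"
    by (auto simp: power2_eq_iff)
  also have "card B - x = 0 \<longleftrightarrow> (\<forall>b\<in>B. 1 - s b * t b = 0)"
    unfolding minus by (rule sum_nonneg_eq_0_iff[OF fin nonneg(1)])
  also have "card B + x = 0 \<longleftrightarrow> (\<forall>b\<in>B. 1 + s b * t b = 0)"
    unfolding plus by (rule sum_nonneg_eq_0_iff[OF fin nonneg(2)])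
  also have "(\<forall>b\<in>B. 1 - s b * t b = 0) \<longleftrightarrow> (\<forall>b\<in>B. s b = t b)"
    using prod by (intro ball_cong refl) fastforce
  also have "(\<forall>b\<in>B. 1 + s b * t b = 0) \<longleftrightarrow> (\<forall>b\<in>B. s b = - t b)"
    using prod by (intro ball_cong refl) fastforce
  finally show "x\<^sup>2 = (real (card B))\<^sup>2 \<longleftrightarrow> (\<forall>b\<in>B. s b = t b) \<or> (\<forall>b\<in>B. s b = - t b)" .
qed

text \<open>
  The Gram matrix has trace \<open>1\<close>, so the equality case of \<open>det_one_plus_gram\<close> requires the squares of its
  \<open>n\<^sup>2\<close> entries to sum to \<open>1\<close>. Each of them is at most \<open>1 / n\<^sup>2\<close>, so all must attain this value.
\<close>

lemma det_one_plus_sign_gram: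
  fixes S :: "nat \<Rightarrow> nat \<Rightarrow> real"
  assumes pos: "0 < n" "0 < m" and S: "\<And>i j. i < n \<Longrightarrow> j < m \<Longrightarrow> S i j \<in> {-1, 1}"
  shows "2 \<le> det (1\<^sub>m n + sign_gram n m S)"
    and "det (1\<^sub>m n + sign_gram n m S) = 2 \<longleftrightarrow>
      (\<forall>i<n. \<forall>k<n. (\<forall>j<m. S i j = S k j) \<or> (\<forall>j<m. S i j = - S k j))"
proof -
  let ?G = "sign_gram n m S"
  define X where "X = mat n m (\<lambda>(i, j). S i j / sqrt (n * m))"
  have X: "X \<in> carrier_mat n m" and G: "?G = X * X\<^sup>T"
    by (simp_all add: X_def sign_gram_def Let_def)
  note carrier = sign_gram_carrier[of n m S] and index = sign_gram_index[of _ n _ m S]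
  have sq: "S i j * S i j = 1" if "i < n" "j < m" for i j using S[OF that] by auto
  have tr: "trace_mat ?G = 1"
    using carrier pos by (simp add: trace_mat_def index sq)
  define q where "q i k = (\<Sum>j<m. S i j * S k j)\<^sup>2" for i k
  have "trace_mat (?G * ?G) = (\<Sum>i<n. \<Sum>k<n. q i k / (real n * real m)\<^sup>2)"
    unfolding trace_mat_mult[OF carrier carrier]
    by (intro sum.cong refl) (simp add: index q_def power2_eq_square mult.commute)
  also have "\<dots> = (\<Sum>i<n. \<Sum>k<n. q i k) / (real n * real m)\<^sup>2"
    by (simp add: sum_divide_distrib)
  finally have "trace_mat (?G * ?G) = (trace_mat ?G)\<^sup>2 \<longleftrightarrow> (\<Sum>i<n. \<Sum>k<n. q i k) = (real n * real m)\<^sup>2"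
    using pos by (auto simp: tr)
  also have "\<dots> \<longleftrightarrow> (\<Sum>i<n. \<Sum>k<n. (real m)\<^sup>2 - q i k) = 0"
    by (auto simp: sum_subtractf power2_eq_square mult_ac)
  also have "\<dots> \<longleftrightarrow> (\<forall>i<n. \<forall>k<n. q i k = (real m)\<^sup>2)"
  proof -
    have le: "q i k \<le> (real m)\<^sup>2" if "i < n" "k < n" for i k
      using sign_scalar_prod(1)[of "{..<m}" "S i" "S k"] S that by (simp add: q_def)
    have inner: "(\<Sum>k<n. (real m)\<^sup>2 - q i k) = 0 \<longleftrightarrow> (\<forall>k<n. q i k = (real m)\<^sup>2)" if "i < n" for i
      using le[OF that] by (subst sum_nonneg_eq_0_iff) auto
    have "(\<Sum>i<n. \<Sum>k<n. (real m)\<^sup>2 - q i k) = 0 \<longleftrightarrow> (\<forall>i\<in>{..<n}. (\<Sum>k<n. (real m)\<^sup>2 - q i k) = 0)"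
      using le by (intro sum_nonneg_eq_0_iff sum_nonneg) auto
    then show ?thesis using inner by auto
  qed
  also have "\<dots> \<longleftrightarrow> (\<forall>i<n. \<forall>k<n. (\<forall>j<m. S i j = S k j) \<or> (\<forall>j<m. S i j = - S k j))"
  proof -
    have "q i k = (real m)\<^sup>2 \<longleftrightarrow> (\<forall>j<m. S i j = S k j) \<or> (\<forall>j<m. S i j = - S k j)" if "i < n" "k < n" for i k
      using sign_scalar_prod(2)[of "{..<m}" "S i" "S k"] S that by (simp add: q_def Ball_def)
    then show ?thesis by blast
  qed
  finally have "trace_mat (?G * ?G) = (trace_mat ?G)\<^sup>2 \<longleftrightarrow>
    (\<forall>i<n. \<forall>k<n. (\<forall>j<m. S i j = S k j) \<or> (\<forall>j<m. S i j = - S k j))" .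
  moreover note det_one_plus_gram[OF X, folded G, unfolded tr]
  ultimately show "2 \<le> det (1\<^sub>m n + ?G)" "det (1\<^sub>m n + ?G) = 2 \<longleftrightarrow>
      (\<forall>i<n. \<forall>k<n. (\<forall>j<m. S i j = S k j) \<or> (\<forall>j<m. S i j = - S k j))"
    by (simp_all add: tr)
qed

lemma out_degree_out_nbrs: "out_degree (with_proj D) u = card (out_nbrs D u)"
proof -
  have "out_arcs (with_proj D) u = Pair u ` out_nbrs D u"
    by (auto simp: out_arcs_def out_nbrs_def)
  then show ?thesis by (simp add: out_degree_def card_image inj_on_def)
qed

lemma in_degree_in_nbrs: "in_degree (with_proj D) u = card {w. (w, u) \<in> parcs D}"
proof -
  have "in_arcs (with_proj D) u = (\<lambda>w. (w, u)) ` {w. (w, u) \<in> parcs D}"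
    by (auto simp: in_arcs_def)
  then show ?thesis by (simp add: in_degree_def card_image inj_on_def)
qed

locale bipartite_eulerian =
  fixes K D :: "'a pair_pre_digraph" and U W :: "'a set"
  assumes fin: "finite U" "finite W" and disj: "U \<inter> W = {}"
    and verts_K: "pverts K = U \<union> W" and arcs_K: "parcs K = U \<times> W \<union> W \<times> U"
    and eulerian: "eulerian_orientation D K"
begin

lemma verts_D: "pverts D = U \<union> W"
  using eulerian verts_K by (simp add: eulerian_orientation_def orientation_def)

lemma arcs_D: "parcs D \<subseteq> U \<times> W \<union> W \<times> U"
  using eulerian arcs_K by (simp add: eulerian_orientation_def orientation_def)

lemma swap_sides: "bipartite_eulerian K D W U"
  using fin disj verts_K arcs_K eulerian by unfold_locales auto

lemma arc_iff:
  assumes "u \<in> U" "w \<in> W"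
  shows "(w, u) \<in> parcs D \<longleftrightarrow> (u, w) \<notin> parcs D"
proof -
  have "(u, w) \<in> parcs K" using assms arcs_K by simp
  then have "((u, w) \<in> parcs D) \<noteq> ((w, u) \<in> parcs D)"
    using eulerian unfolding eulerian_orientation_def orientation_def by blast
  then show ?thesis by simp
qed

lemma out_nbrs_subset: "u \<in> U \<Longrightarrow> out_nbrs D u \<subseteq> W"
  using arcs_D disj by (auto simp: out_nbrs_def)

lemma card_out_nbrs:
  assumes "u \<in> U"
  shows "2 * card (out_nbrs D u) = card W"
proof -
  have "card (out_nbrs D u) = card {w. (w, u) \<in> parcs D}"
    using eulerian verts_D assms
    by (auto simp: eulerian_orientation_def in_degree_in_nbrs out_degree_out_nbrs)
  also have "{w. (w, u) \<in> parcs D} = W - out_nbrs D u"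
  proof -
    have "w \<in> W" if "(w, u) \<in> parcs D" for w using that arcs_D disj assms by auto
    then show ?thesis unfolding out_nbrs_def using arc_iff[OF assms] by auto
  qed
  also have "card \<dots> = card W - card (out_nbrs D u)"
    using out_nbrs_subset[OF assms] fin by (meson card_Diff_subset finite_subset)
  finally have "card (out_nbrs D u) = card W - card (out_nbrs D u)" .
  moreover have "card (out_nbrs D u) \<le> card W"
    using out_nbrs_subset[OF assms] fin by (intro card_mono) auto
  ultimately show ?thesis by linarith
qed

lemma sum_signs:
  assumes "u \<in> U"
  shows "(\<Sum>w\<in>W. if (u, w) \<in> parcs D then 1 else -1 :: real) = 0"
proof -
  have "(\<Sum>w\<in>W. if (u, w) \<in> parcs D then 1 else -1 :: real)
      = (\<Sum>w\<in>W. 2 * of_bool (w \<in> out_nbrs D u) - 1)"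
    by (intro sum.cong) (auto simp: out_nbrs_def)
  also have "\<dots> = 2 * card (out_nbrs D u) - real (card W)"
    using out_nbrs_subset[OF assms] fin
    by (simp add: sum_subtractf Int_absorb1 Int_absorb2 flip: sum_distrib_left)
  also have "\<dots> = 0" using card_out_nbrs[OF assms] by simp
  finally show ?thesis .
qed

lemma disjoint_out_nbrs_iff:
  assumes "u \<in> U" "u' \<in> U"
  shows "out_nbrs D u \<inter> out_nbrs D u' = {} \<longleftrightarrow> out_nbrs D u' = W - out_nbrs D u"
proof
  assume "out_nbrs D u \<inter> out_nbrs D u' = {}"
  then have "out_nbrs D u' \<subseteq> W - out_nbrs D u" using out_nbrs_subset[OF assms(2)] by auto
  moreover have "card (out_nbrs D u') = card (W - out_nbrs D u)"
  proof -
    have "card (W - out_nbrs D u) = card W - card (out_nbrs D u)"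
      using out_nbrs_subset[OF assms(1)] fin by (meson card_Diff_subset finite_subset)
    then show ?thesis using card_out_nbrs[OF assms(1)] card_out_nbrs[OF assms(2)] by linarith
  qed
  ultimately show "out_nbrs D u' = W - out_nbrs D u"
    using fin by (intro card_subset_eq) auto
qed auto

text \<open>
  Here \<open>d\<close> is the determinant of \<open>1 + G\<close> for the sign matrix of the orientation. The vertices are
  numbered with those of \<open>U\<close> first, so that the Laplacian takes the block form of \<open>sign_laplacian\<close>.
\<close>

lemma arb_formula:
  assumes nonempty: "U \<noteq> {}" "W \<noteq> {}" and r: "r \<in> U \<union> W"
  obtains d where "real (arb D r) = (card W / 2) ^ (card U - 1) * (card U / 2) ^ (card W - 1) * (d / 2)"
    and "2 \<le> d"
    and "d = 2 \<longleftrightarrow> (\<forall>u\<in>U. \<forall>u'\<in>U. out_nbrs D u = out_nbrs D u' \<or> out_nbrs D u \<inter> out_nbrs D u' = {})"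
proof -
  interpret sw: bipartite_eulerian K D W U by (rule swap_sides)
  define n where "n = card U"
  define m where "m = card W"
  have pos: "0 < n" "0 < m" using fin nonempty by (auto simp: n_def m_def card_gt_0_iff)
  obtain a where a: "bij_betw a {..<n} U"
    using ex_bij_betw_nat_finite[OF fin(1)] by (auto simp: n_def atLeast0LessThan)
  obtain b where b: "bij_betw b {..<m} W"
    using ex_bij_betw_nat_finite[OF fin(2)] by (auto simp: m_def atLeast0LessThan)
  define v where "v i = (if i < n then a i else b (i - n))" for i
  have a_in: "a i \<in> U" if "i < n" for i using a that by (auto simp: bij_betw_def)
  have b_in: "b i \<in> W" if "i < m" for i using b that by (auto simp: bij_betw_def)
  have v: "bij_betw v {..<n + m} (U \<union> W)"
  proof -
    have "bij_betw v {..<n} U" using a by (subst bij_betw_cong[of _ _ a]) (auto simp: v_def)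
    moreover have "bij_betw v {n..<n + m} W"
    proof -
      have "bij_betw (\<lambda>i. i - n) {n..<n + m} {..<m}"
        by (rule bij_betw_byWitness[of _ "\<lambda>i. i + n"]) auto
      from bij_betw_trans[OF this b] show ?thesis
        by (subst bij_betw_cong[of _ _ "b \<circ> (\<lambda>i. i - n)"]) (auto simp: v_def)
    qed
    moreover have "{..<n} \<union> {n..<n + m} = {..<n + m}" by auto
    ultimately show ?thesis using bij_betw_combine[of v "{..<n}" U "{n..<n + m}" W] disj by simp
  qed
  define S :: "nat \<Rightarrow> nat \<Rightarrow> real" where "S i j = (if (a i, b j) \<in> parcs D then 1 else -1)" for i j
  have rows: "(\<Sum>j<m. S i j) = 0" if "i < n" for i
    using sum_signs[OF a_in[OF that]]
    unfolding S_def sum.reindex_bij_betw[OF b, of "\<lambda>w. if (a i, w) \<in> parcs D then 1 else -1"] .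
  have cols: "(\<Sum>i<n. S i j) = 0" if "j < m" for j
  proof -
    have "(\<Sum>i<n. S i j) = (\<Sum>u\<in>U. if (u, b j) \<in> parcs D then 1 else -1)"
      unfolding S_def by (rule sum.reindex_bij_betw[OF a])
    also have "\<dots> = - (\<Sum>u\<in>U. if (b j, u) \<in> parcs D then 1 else -1)"
      unfolding sum_negf[symmetric] using arc_iff b_in[OF that] by (intro sum.cong) auto
    also have "\<dots> = 0" using sw.sum_signs[OF b_in[OF that]] by simp
    finally show ?thesis .
  qed
  obtain r0 where r0: "r0 < n + m" "v r0 = r"
    using bij_betw_imp_surj_on[OF v] r by (metis imageE lessThan_iff)
  have v_eq: "v i = v j \<longleftrightarrow> i = j" if "i < n + m" "j < n + m" for i j
    using v that by (auto simp: bij_betw_def inj_on_def)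
  have out: "out_nbrs D u \<subseteq> U \<union> W" for u using arcs_D by (auto simp: out_nbrs_def)
  have wfD: "finite (pverts D)" "parcs D \<subseteq> pverts D \<times> pverts D" "r \<in> pverts D"
    using fin arcs_D r by (auto simp: verts_D)
  have "real (arb D r) = card {g \<in> Pi\<^sub>E (U \<union> W - {r}) (out_nbrs D).
      \<forall>u \<in> U \<union> W. (u, r) \<in> (choice_arcs (U \<union> W) r g)\<^sup>*}"
    using arb_eq_card_root_choices[OF wfD] by (simp add: root_choices_def verts_D)
  also have "\<dots> = det (mat (n + m) (n + m) (\<lambda>(i, j). if v i = r then of_bool (v j = r)
      else real (card (out_nbrs D (v i))) * of_bool (i = j) - of_bool (v j \<in> out_nbrs D (v i))))"
    using out by (intro matrix_tree_choices[OF v r, symmetric])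
  also have "\<dots> = det (mat (n + m) (n + m)
      (\<lambda>(i, j). if i = r0 then if j = r0 then 1 else 0 else sign_laplacian n m S i j))"
  proof (intro arg_cong[where f = det] eq_matI)
    fix i j
    assume "i < dim_row (mat (n + m) (n + m)
        (\<lambda>(i, j). if i = r0 then if j = r0 then 1 else 0 else sign_laplacian n m S i j))"
      "j < dim_col (mat (n + m) (n + m)
        (\<lambda>(i, j). if i = r0 then if j = r0 then 1 else 0 else sign_laplacian n m S i j))"
    then have ij: "i < n + m" "j < n + m" by auto
    have "real (card (out_nbrs D (v i))) * of_bool (i = j) - of_bool (v j \<in> out_nbrs D (v i))
        = sign_laplacian n m S i j"
    proof (cases "i < n")
      case True
      then have i: "v i = a i" "a i \<in> U" using a_in by (auto simp: v_def)
      have c: "real (card (out_nbrs D (v i))) = m / 2"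
        using card_out_nbrs[OF i(2)] by (simp add: m_def i(1))
      show ?thesis
      proof (cases "j < n")
        case True
        then have "v j \<notin> out_nbrs D (v i)"
          using out_nbrs_subset[OF i(2)] disj a_in[of j] i(1) by (auto simp: v_def)
        then show ?thesis using \<open>i < n\<close> True c by (auto simp: sign_laplacian_def)
      next
        case False
        then show ?thesis using \<open>i < n\<close> by (auto simp: sign_laplacian_def v_def S_def out_nbrs_def)
      qed
    next
      case False
      then have i: "v i = b (i - n)" "b (i - n) \<in> W" using b_in ij by (auto simp: v_def)
      have c: "real (card (out_nbrs D (v i))) = n / 2"
        using sw.card_out_nbrs[OF i(2)] by (simp add: n_def i(1))
      show ?thesis
      proof (cases "j < n")
        case True
        then show ?thesis using False i arc_iff[OF a_in i(2), of j]
          by (auto simp: sign_laplacian_def v_def S_def out_nbrs_def)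
      next
        case j: False
        then have "v j \<notin> out_nbrs D (v i)"
          using sw.out_nbrs_subset[OF i(2)] disj b_in[of "j - n"] i(1) ij by (auto simp: v_def)
        then show ?thesis using False j c by (auto simp: sign_laplacian_def)
      qed
    qed
    then show "mat (n + m) (n + m) (\<lambda>(i, j). if v i = r then of_bool (v j = r)
        else real (card (out_nbrs D (v i))) * of_bool (i = j) - of_bool (v j \<in> out_nbrs D (v i))) $$ (i, j)
      = mat (n + m) (n + m)
        (\<lambda>(i, j). if i = r0 then if j = r0 then 1 else 0 else sign_laplacian n m S i j) $$ (i, j)"
      using ij r0 v_eq by auto
  qed auto
  also have "\<dots> = (m / 2) ^ (n - 1) * (n / 2) ^ (m - 1) * (det (1\<^sub>m n + sign_gram n m S) / 2)"
    by (rule det_sign_laplacian_reduced[OF pos rows cols r0(1)])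
  finally have arb: "real (arb D r) = \<dots>" .
  have S: "S i j \<in> {-1, 1}" for i j by (simp add: S_def)
  have rel: "(\<forall>j<m. S i j = S k j) \<or> (\<forall>j<m. S i j = - S k j) \<longleftrightarrow>
      out_nbrs D (a i) = out_nbrs D (a k) \<or> out_nbrs D (a i) \<inter> out_nbrs D (a k) = {}"
    if ik: "i < n" "k < n" for i k
  proof -
    have all_W: "(\<forall>j<m. P (b j)) \<longleftrightarrow> (\<forall>w\<in>W. P w)" for P
      using b by (auto simp: bij_betw_def)
    have sub: "out_nbrs D (a i) \<subseteq> W" "out_nbrs D (a k) \<subseteq> W"
      using out_nbrs_subset a_in ik by auto
    have eq: "(\<forall>j<m. S i j = S k j) \<longleftrightarrow> (\<forall>w\<in>W. w \<in> out_nbrs D (a i) \<longleftrightarrow> w \<in> out_nbrs D (a k))"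
      unfolding all_W[symmetric] by (auto simp: S_def out_nbrs_def)
    have opp: "(\<forall>j<m. S i j = - S k j) \<longleftrightarrow> (\<forall>w\<in>W. w \<in> out_nbrs D (a k) \<longleftrightarrow> w \<notin> out_nbrs D (a i))"
      unfolding all_W[symmetric] by (auto simp: S_def out_nbrs_def)
    have same: "(\<forall>w\<in>W. w \<in> out_nbrs D (a i) \<longleftrightarrow> w \<in> out_nbrs D (a k)) \<longleftrightarrow> out_nbrs D (a i) = out_nbrs D (a k)"
      using sub by blast
    have compl: "(\<forall>w\<in>W. w \<in> out_nbrs D (a k) \<longleftrightarrow> w \<notin> out_nbrs D (a i)) \<longleftrightarrow> out_nbrs D (a k) = W - out_nbrs D (a i)"
      using sub by blast
    show ?thesis
      unfolding eq opp same compl disjoint_out_nbrs_iff[OF a_in[OF ik(1)] a_in[OF ik(2)]] ..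
  qed
  have all_U: "(\<forall>i<n. P (a i)) \<longleftrightarrow> (\<forall>u\<in>U. P u)" for P
    using a by (auto simp: bij_betw_def)
  note gram = det_one_plus_sign_gram[of n m S, OF pos S]
  show ?thesis
  proof (rule that)
    show "real (arb D r) = (card W / 2) ^ (card U - 1) * (card U / 2) ^ (card W - 1)
        * (det (1\<^sub>m n + sign_gram n m S) / 2)"
      using arb by (simp only: n_def m_def)
    show "2 \<le> det (1\<^sub>m n + sign_gram n m S)" by (rule gram(1))
    show "det (1\<^sub>m n + sign_gram n m S) = 2 \<longleftrightarrow>
        (\<forall>u\<in>U. \<forall>u'\<in>U. out_nbrs D u = out_nbrs D u' \<or> out_nbrs D u \<inter> out_nbrs D u' = {})"
      unfolding all_U[symmetric] gram(2) using rel by auto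
  qed
qed

end

section \<open>Blow-ups of the directed 4-cycle\<close>

text \<open>
  For digraphs whose arcs are pairs, the action of an isomorphism on arcs is determined by its action on
  vertices.
\<close>

lemma digraph_iso_with_proj_iff:
  "digraph_iso (with_proj G) (with_proj H) \<longleftrightarrow> wf_digraph (with_proj G) \<and>
    (\<exists>f. inj_on f (pverts G) \<and> pverts H = f ` pverts G \<and> parcs H = (\<lambda>(u, w). (f u, f w)) ` parcs G)"
proof
  assume "digraph_iso (with_proj G) (with_proj H)"
  then obtain h where h: "pre_digraph.digraph_isomorphism (with_proj G) h"
    and H: "with_proj H = app_iso h (with_proj G)"
    by (auto simp: digraph_iso_def)
  have ends: "iso_tail h = fst" "iso_head h = snd"
    using arg_cong[OF H, of tail] arg_cong[OF H, of head] by simp_all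
  have "iso_arcs h e = (iso_verts h (fst e), iso_verts h (snd e))" if "e \<in> parcs G" for e
    using h that by (auto simp: pre_digraph.digraph_isomorphism_def ends prod_eq_iff)
  then have "parcs H = (\<lambda>(u, w). (iso_verts h u, iso_verts h w)) ` parcs G"
    using arg_cong[OF H, of arcs] by (auto simp: case_prod_beta intro!: image_cong)
  moreover have "pverts H = iso_verts h ` pverts G"
    using arg_cong[OF H, of verts] by simp
  ultimately show "wf_digraph (with_proj G) \<and>
    (\<exists>f. inj_on f (pverts G) \<and> pverts H = f ` pverts G \<and> parcs H = (\<lambda>(u, w). (f u, f w)) ` parcs G)"
    using h by (auto simp: pre_digraph.digraph_isomorphism_def)
next
  assume "wf_digraph (with_proj G) \<and>
    (\<exists>f. inj_on f (pverts G) \<and> pverts H = f ` pverts G \<and> parcs H = (\<lambda>(u, w). (f u, f w)) ` parcs G)"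
  then obtain f where wf: "wf_digraph (with_proj G)" and f: "inj_on f (pverts G)"
    "pverts H = f ` pverts G" "parcs H = (\<lambda>(u, w). (f u, f w)) ` parcs G"
    by blast
  define h where "h = \<lparr>iso_verts = f, iso_arcs = \<lambda>(u, w). (f u, f w), iso_head = snd, iso_tail = fst\<rparr>"
  have "inj_on (\<lambda>(u, w). (f u, f w)) (parcs G)"
  proof -
    have "parcs G \<subseteq> pverts G \<times> pverts G"
      using wf_digraph.tail_in_verts[OF wf] wf_digraph.head_in_verts[OF wf] by fastforce
    moreover have "inj_on (\<lambda>(u, w). (f u, f w)) (pverts G \<times> pverts G)"
      using f(1) by (auto simp: inj_on_def)
    ultimately show ?thesis by (rule inj_on_subset[rotated])
  qed
  then have "pre_digraph.digraph_isomorphism (with_proj G) h"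
    using wf f(1) by (auto simp: pre_digraph.digraph_isomorphism_def h_def)
  moreover have "with_proj H = app_iso h (with_proj G)"
    by (simp add: app_iso_def h_def f with_proj_def)
  ultimately show "digraph_iso (with_proj G) (with_proj H)"
    unfolding digraph_iso_def by blast
qed

text \<open>
  In a blow-up, adjacency depends only on the vertices of \<open>C\<close> that have been blown up; the colouring is
  the first component of the isomorphism.
\<close>

lemma blow_up_iso_imp_colouring:
  assumes "digraph_iso (with_proj D) (with_proj (blow_up C s))"
  shows "\<exists>c. \<forall>u \<in> pverts D. \<forall>w \<in> pverts D. (u, w) \<in> parcs D \<longleftrightarrow> (c u, c w) \<in> parcs C"
proof -
  obtain f where wf: "wf_digraph (with_proj D)" and f: "inj_on f (pverts D)"
    "pverts (blow_up C s) = f ` pverts D" "parcs (blow_up C s) = (\<lambda>(u, w). (f u, f w)) ` parcs D"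
    using assms unfolding digraph_iso_with_proj_iff by blast
  have sub: "parcs D \<subseteq> pverts D \<times> pverts D"
    using wf_digraph.tail_in_verts[OF wf] wf_digraph.head_in_verts[OF wf] by fastforce
  have "(u, w) \<in> parcs D \<longleftrightarrow> (fst (f u), fst (f w)) \<in> parcs C"
    if uw: "u \<in> pverts D" "w \<in> pverts D" for u w
  proof -
    have "(u, w) \<in> parcs D \<longleftrightarrow> (f u, f w) \<in> parcs (blow_up C s)"
    proof
      assume "(f u, f w) \<in> parcs (blow_up C s)"
      then obtain u' w' where "(u', w') \<in> parcs D" "f u = f u'" "f w = f w'"
        unfolding f(3) by auto
      then show "(u, w) \<in> parcs D" using inj_onD[OF f(1)] uw sub by (metis SigmaE2 subsetD)
    qed (auto simp: f(3))
    also have "\<dots> \<longleftrightarrow> (fst (f u), fst (f w)) \<in> parcs C"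
    proof -
      have "f u \<in> pverts (blow_up C s)" "f w \<in> pverts (blow_up C s)" using uw f(2) by auto
      then show ?thesis by (cases "f u"; cases "f w") (auto simp: blow_up_def)
    qed
    finally show ?thesis .
  qed
  then show ?thesis by (intro exI[of _ "\<lambda>u. fst (f u)"]) blast
qed

text \<open>
  Conversely, a colouring that determines adjacency becomes an isomorphism by numbering each colour
  class arbitrarily.
\<close>

lemma colouring_imp_blow_up_iso:
  assumes fin: "finite (pverts D)" and sub: "parcs D \<subseteq> pverts D \<times> pverts D"
    and c: "\<And>u. u \<in> pverts D \<Longrightarrow> c u \<in> pverts C"
    and arcs: "\<And>u w. u \<in> pverts D \<Longrightarrow> w \<in> pverts D \<Longrightarrow> (u, w) \<in> parcs D \<longleftrightarrow> (c u, c w) \<in> parcs C"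
    and size: "\<And>i. i \<in> pverts C \<Longrightarrow> card {u \<in> pverts D. c u = i} = s i"
    and wf_C: "parcs C \<subseteq> pverts C \<times> pverts C"
  shows "digraph_iso (with_proj D) (with_proj (blow_up C s))"
proof -
  have "\<exists>h. bij_betw h {u \<in> pverts D. c u = i} {..<s i}" if "i \<in> pverts C" for i
    using ex_bij_betw_finite_nat[of "{u \<in> pverts D. c u = i}"] fin size[OF that]
    by (auto simp: atLeast0LessThan)
  then obtain h where h: "\<And>i. i \<in> pverts C \<Longrightarrow> bij_betw (h i) {u \<in> pverts D. c u = i} {..<s i}"
    by metis
  define f where "f u = (c u, h (c u) u)" for u
  have wf: "wf_digraph (with_proj D)" using sub by unfold_locales auto
  have inj: "inj_on f (pverts D)"
  proof (rule inj_onI)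
    fix u w assume "u \<in> pverts D" "w \<in> pverts D" "f u = f w"
    then show "u = w"
      using bij_betw_imp_inj_on[OF h[OF c[of u]]] by (auto simp: f_def inj_on_def)
  qed
  have img: "(i, k) \<in> f ` pverts D \<longleftrightarrow> i \<in> pverts C \<and> k < s i" for i k
  proof
    assume "(i, k) \<in> f ` pverts D"
    then obtain u where u: "u \<in> pverts D" "i = c u" "k = h (c u) u" by (auto simp: f_def)
    then have "h (c u) u \<in> {..<s (c u)}"
      using bij_betw_apply[OF h[OF c[OF u(1)]]] by blast
    then show "i \<in> pverts C \<and> k < s i" using u c by simp
  next
    assume ik: "i \<in> pverts C \<and> k < s i"
    then have "k \<in> h i ` {u \<in> pverts D. c u = i}"
      using bij_betw_imp_surj_on[OF h] by simp
    then show "(i, k) \<in> f ` pverts D" by (auto simp: f_def)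
  qed
  have "pverts (blow_up C s) = f ` pverts D"
    using img by (auto simp: blow_up_def)
  moreover have "parcs (blow_up C s) = (\<lambda>(u, w). (f u, f w)) ` parcs D"
  proof (rule equalityI; rule subsetI)
    fix e assume "e \<in> parcs (blow_up C s)"
    then obtain i k j l where e: "e = ((i, k), (j, l))" "(i, j) \<in> parcs C" "k < s i" "l < s j"
      by (auto simp: blow_up_def)
    then have "(i, k) \<in> f ` pverts D" "(j, l) \<in> f ` pverts D"
      unfolding img using wf_C by auto
    then obtain u w where uw: "u \<in> pverts D" "f u = (i, k)" "w \<in> pverts D" "f w = (j, l)"
      by (metis imageE)
    then have "(u, w) \<in> parcs D" using arcs e(2) by (simp add: f_def)
    then show "e \<in> (\<lambda>(u, w). (f u, f w)) ` parcs D" using e(1) uw by force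
  next
    fix e assume "e \<in> (\<lambda>(u, w). (f u, f w)) ` parcs D"
    then obtain u w where uw: "(u, w) \<in> parcs D" "e = (f u, f w)" by auto
    then have V: "u \<in> pverts D" "w \<in> pverts D" using sub by auto
    have "h (c u) u < s (c u)" "h (c w) w < s (c w)"
      using V img[of "c u" "h (c u) u"] img[of "c w" "h (c w) w"] by (auto simp: f_def)
    moreover have "(c u, c w) \<in> parcs C" using uw(1) arcs[OF V] by simp
    ultimately show "e \<in> parcs (blow_up C s)"
      by (simp add: uw(2) blow_up_def f_def)
  qed
  ultimately show ?thesis using wf inj unfolding digraph_iso_with_proj_iff by blast
qed

lemma directed_cycle_4:
  "pverts (directed_cycle 4) = {0, 1, 2, 3}"
  "parcs (directed_cycle 4) = {(0, 1), (1, 2), (2, 3), (3, 0)}"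
proof -
  have less_4: "i < 4 \<longleftrightarrow> i = 0 \<or> i = 1 \<or> i = 2 \<or> i = (3 :: nat)" for i by auto
  show "pverts (directed_cycle 4) = {0, 1, 2, 3}"
    by (auto simp: directed_cycle_def)
  show "parcs (directed_cycle 4) = {(0, 1), (1, 2), (2, 3), (3, 0)}"
    unfolding directed_cycle_def less_4 by auto
qed

definition four_colouring :: "'a set \<Rightarrow> 'a set \<Rightarrow> 'a set \<Rightarrow> 'a \<Rightarrow> nat" where
  "four_colouring U U1 W1 u = (if u \<in> U then if u \<in> U1 then 0 else 2 else if u \<in> W1 then 1 else 3)"

lemma four_colouring_iso:
  assumes fin: "finite U" "finite W" and disj: "U \<inter> W = {}"
    and U1: "U1 \<subseteq> U" "2 * card U1 = card U" and W1: "W1 \<subseteq> W" "2 * card W1 = card W"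
    and verts: "pverts D = U \<union> W" and sub: "parcs D \<subseteq> pverts D \<times> pverts D"
    and arcs: "\<And>u w. u \<in> U \<union> W \<Longrightarrow> w \<in> U \<union> W \<Longrightarrow> (u, w) \<in> parcs D \<longleftrightarrow>
      (four_colouring U U1 W1 u, four_colouring U U1 W1 w) \<in> parcs (directed_cycle 4)"
  shows "digraph_iso (with_proj D) (with_proj (cycle4_blow_up (card U) (card W)))"
  unfolding cycle4_blow_up_def
proof (rule colouring_imp_blow_up_iso)
  let ?c = "four_colouring U U1 W1"
  fix i :: nat assume i: "i \<in> pverts (directed_cycle 4)"
  have "{u \<in> U \<union> W. ?c u = 0} = U1" "{u \<in> U \<union> W. ?c u = 2} = U - U1"
    "{u \<in> U \<union> W. ?c u = 1} = W1" "{u \<in> U \<union> W. ?c u = 3} = W - W1"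
    using U1(1) W1(1) disj by (auto simp: four_colouring_def split: if_splits)
  moreover have "card (U - U1) = card U div 2" "card (W - W1) = card W div 2"
    using U1 W1 fin by (simp_all add: card_Diff_subset finite_subset)
  moreover have "card U1 = card U div 2" "card W1 = card W div 2" using U1(2) W1(2) by auto
  ultimately show "card {u \<in> pverts D. ?c u = i} = (if even i then card U div 2 else card W div 2)"
    using i unfolding verts directed_cycle_4 by auto
qed (use fin verts sub arcs in \<open>auto simp: directed_cycle_4 four_colouring_def\<close>)

context bipartite_eulerian
begin

lemma arcs_D_verts: "parcs D \<subseteq> pverts D \<times> pverts D"
  using arcs_D verts_D by auto

text \<open>
  Every vertex of the directed 4-cycle has a single in-neighbour, so vertices with a common
  out-neighbour have the same colour and hence the same out-neighbourhood.
\<close>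

lemma iso_imp_equal_or_disjoint:
  assumes iso: "digraph_iso (with_proj D) (with_proj (cycle4_blow_up n m))" and u: "u \<in> U" "u' \<in> U"
  shows "out_nbrs D u = out_nbrs D u' \<or> out_nbrs D u \<inter> out_nbrs D u' = {}"
proof (rule disjCI)
  assume "out_nbrs D u \<inter> out_nbrs D u' \<noteq> {}"
  then obtain w where w: "(u, w) \<in> parcs D" "(u', w) \<in> parcs D" by (auto simp: out_nbrs_def)
  obtain c where c: "\<And>u w. u \<in> pverts D \<Longrightarrow> w \<in> pverts D \<Longrightarrow>
      (u, w) \<in> parcs D \<longleftrightarrow> (c u, c w) \<in> parcs (directed_cycle 4)"
    using blow_up_iso_imp_colouring[OF iso[unfolded cycle4_blow_up_def]] by blast
  have V: "u \<in> pverts D" "u' \<in> pverts D" using u verts_D by auto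
  have in_V: "x \<in> pverts D" if "(y, x) \<in> parcs D" for x y using that arcs_D_verts by auto
  have "(c u, c w) \<in> parcs (directed_cycle 4)" "(c u', c w) \<in> parcs (directed_cycle 4)"
    using c V w in_V by blast+
  then have "c u = c u'" by (auto simp: directed_cycle_4)
  then have "(u, x) \<in> parcs D \<longleftrightarrow> (u', x) \<in> parcs D" for x
    using c V in_V by metis
  then show "out_nbrs D u = out_nbrs D u'" by (simp add: out_nbrs_def)
qed

text \<open>
  Since every out-neighbourhood of a vertex of \<open>U\<close> is half of \<open>W\<close>, disjoint ones are complementary. So
  there are only two of them, \<open>W1\<close> and \<open>W - W1\<close>, and the four classes of the blow-up are determined
  by whether a vertex of \<open>U\<close> has out-neighbourhood \<open>W1\<close> and whether a vertex of \<open>W\<close> lies in \<open>W1\<close>.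
\<close>

lemma equal_or_disjoint_imp_iso:
  assumes nonempty: "U \<noteq> {}" "W \<noteq> {}"
    and P: "\<forall>u\<in>U. \<forall>u'\<in>U. out_nbrs D u = out_nbrs D u' \<or> out_nbrs D u \<inter> out_nbrs D u' = {}"
  shows "digraph_iso (with_proj D) (with_proj (cycle4_blow_up (card U) (card W)))"
proof -
  interpret sw: bipartite_eulerian K D W U by (rule swap_sides)
  obtain a where a: "a \<in> U" using nonempty by blast
  define W1 where "W1 = out_nbrs D a"
  define U1 where "U1 = {u \<in> U. out_nbrs D u = W1}"
  have W1: "W1 \<subseteq> W" "2 * card W1 = card W"
    using out_nbrs_subset[OF a] card_out_nbrs[OF a] by (simp_all add: W1_def)
  have out_U1: "out_nbrs D u = W1" if "u \<in> U1" for u using that by (simp add: U1_def)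
  have out_U2: "out_nbrs D u = W - W1" if "u \<in> U" "u \<notin> U1" for u
    using P a that disjoint_out_nbrs_iff[OF a that(1)] by (auto simp: W1_def U1_def)
  have UW: "(u, w) \<in> parcs D \<longleftrightarrow> (u \<in> U1 \<longleftrightarrow> w \<in> W1)" if "u \<in> U" "w \<in> W" for u w
  proof -
    have "(u, w) \<in> parcs D \<longleftrightarrow> w \<in> out_nbrs D u" by (simp add: out_nbrs_def)
    then show ?thesis using out_U1 out_U2[OF that(1)] that(2) by (cases "u \<in> U1") auto
  qed
  have "W1 \<noteq> {}" using W1 nonempty fin by auto
  then obtain b where b: "b \<in> W1" by blast
  then have bW: "b \<in> W" using W1 by auto
  \<comment> \<open>the degree condition at a vertex of \<open>W1\<close> is what makes \<open>U1\<close> half of \<open>U\<close>\<close>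
  have "out_nbrs D b = U - U1"
  proof -
    have "(b, u) \<in> parcs D \<longleftrightarrow> u \<in> U - U1" if "u \<in> U" for u
      using UW[OF that bW] arc_iff[OF that bW] b that by auto
    then show ?thesis using sw.out_nbrs_subset[OF bW] by (auto simp: out_nbrs_def)
  qed
  then have "2 * card (U - U1) = card U" using sw.card_out_nbrs[OF bW] by simp
  moreover have "U1 \<subseteq> U" by (auto simp: U1_def)
  moreover have "card (U - U1) = card U - card U1" "card U1 \<le> card U"
    using fin \<open>U1 \<subseteq> U\<close> by (simp_all add: card_Diff_subset finite_subset card_mono)
  ultimately have U1: "U1 \<subseteq> U" "2 * card U1 = card U" by auto
  show ?thesis
  proof (rule four_colouring_iso[OF fin disj U1 W1 verts_D arcs_D_verts])
    fix u w assume uw: "u \<in> U \<union> W" "w \<in> U \<union> W"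
    have same: "(x, y) \<notin> parcs D" if "x \<in> U \<and> y \<in> U \<or> x \<in> W \<and> y \<in> W" for x y
      using that arcs_D disj by auto
    have not_U: "x \<notin> U" if "x \<in> W" for x using that disj by auto
    consider "u \<in> U" "w \<in> U" | "u \<in> U" "w \<in> W" | "u \<in> W" "w \<in> U" | "u \<in> W" "w \<in> W"
      using uw by blast
    then show "(u, w) \<in> parcs D \<longleftrightarrow>
      (four_colouring U U1 W1 u, four_colouring U U1 W1 w) \<in> parcs (directed_cycle 4)"
    proof cases
      case 1
      then show ?thesis using same[of u w] by (simp add: directed_cycle_4 four_colouring_def)
    next
      case 2
      then show ?thesis using UW[of u w] not_U by (simp add: directed_cycle_4 four_colouring_def)
    next
      case 3
      then show ?thesis using UW[of w u] arc_iff[of w u] not_U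
        by (simp add: directed_cycle_4 four_colouring_def)
    next
      case 4
      then show ?thesis using same[of u w] not_U by (simp add: directed_cycle_4 four_colouring_def)
    qed
  qed
qed

lemma arb_bound:
  assumes nonempty: "U \<noteq> {}" "W \<noteq> {}" and r: "r \<in> U \<union> W"
    and even: "even (card U)" "even (card W)"
  defines "b \<equiv> (card W div 2) ^ (card U - 1) * (card U div 2) ^ (card W - 1)"
  shows "b \<le> arb D r"
    and "arb D r = b \<longleftrightarrow> digraph_iso (with_proj D) (with_proj (cycle4_blow_up (card U) (card W)))"
proof -
  obtain d where d: "real (arb D r) = (card W / 2) ^ (card U - 1) * (card U / 2) ^ (card W - 1) * (d / 2)"
    "2 \<le> d" "d = 2 \<longleftrightarrow> (\<forall>u\<in>U. \<forall>u'\<in>U. out_nbrs D u = out_nbrs D u' \<or> out_nbrs D u \<inter> out_nbrs D u' = {})"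
    using arb_formula[OF nonempty r] by blast
  have b: "real b = (card W / 2) ^ (card U - 1) * (card U / 2) ^ (card W - 1)"
    using even by (simp add: b_def real_of_nat_div)
  have "0 < card U" "0 < card W" using nonempty fin by (auto simp: card_gt_0_iff)
  then have pos: "0 < real b" unfolding b by simp
  have arb: "real (arb D r) = real b * (d / 2)" using d(1) b by simp
  have "real b * 1 \<le> real b * (d / 2)" using pos d(2) by (intro mult_left_mono) auto
  then show "b \<le> arb D r" using arb by simp
  have "arb D r = b \<longleftrightarrow> real (arb D r) = real b" by simp
  also have "\<dots> \<longleftrightarrow> d = 2" using pos arb by auto
  finally have "arb D r = b \<longleftrightarrow> d = 2" .
  then show "arb D r = b \<longleftrightarrow> digraph_iso (with_proj D) (with_proj (cycle4_blow_up (card U) (card W)))"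
    using d(3) equal_or_disjoint_imp_iso[OF nonempty] iso_imp_equal_or_disjoint by blast
qed

end

lemma eulerian_orientation_exists:
  assumes fin: "finite U" "finite W" and disj: "U \<inter> W = {}"
    and K: "pverts K = U \<union> W" "parcs K = U \<times> W \<union> W \<times> U"
    and even: "even (card U)" "even (card W)"
  shows "\<exists>D. eulerian_orientation D K \<and>
    digraph_iso (with_proj D) (with_proj (cycle4_blow_up (card U) (card W)))"
proof -
  obtain U1 where U1: "U1 \<subseteq> U" "card U1 = card U div 2"
    using obtain_subset_with_card_n[of "card U div 2" U] by auto
  obtain W1 where W1: "W1 \<subseteq> W" "card W1 = card W div 2"
    using obtain_subset_with_card_n[of "card W div 2" W] by auto
  define D where "D = \<lparr>pverts = U \<union> W,
    parcs = U1 \<times> W1 \<union> W1 \<times> (U - U1) \<union> (U - U1) \<times> (W - W1) \<union> (W - W1) \<times> U1\<rparr>"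
  have half: "card (U - U1) = card U1" "card (W - W1) = card W1"
    using U1 W1 even fin by (auto simp: card_Diff_subset finite_subset elim!: evenE)
  have "orientation D K"
    using U1(1) W1(1) disj unfolding orientation_def K D_def by auto
  moreover have "in_degree (with_proj D) u = out_degree (with_proj D) u" if "u \<in> pverts D" for u
  proof -
    have not_both: "x \<notin> W" if "x \<in> U" for x using that disj by auto
    have "u \<in> U \<union> W" using that by (simp add: D_def)
    then consider "u \<in> U1" | "u \<in> U - U1" | "u \<in> W1" | "u \<in> W - W1"
      by blast
    then show ?thesis
    proof cases
      case 1
      then have "{w. (w, u) \<in> parcs D} = W - W1" "out_nbrs D u = W1"
        using U1(1) W1(1) not_both by (auto simp: D_def out_nbrs_def)
      then show ?thesis by (simp add: in_degree_in_nbrs out_degree_out_nbrs half)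
    next
      case 2
      then have "{w. (w, u) \<in> parcs D} = W1" "out_nbrs D u = W - W1"
        using U1(1) W1(1) not_both by (auto simp: D_def out_nbrs_def)
      then show ?thesis by (simp add: in_degree_in_nbrs out_degree_out_nbrs half)
    next
      case 3
      then have "{w. (w, u) \<in> parcs D} = U1" "out_nbrs D u = U - U1"
        using U1(1) W1(1) not_both by (auto simp: D_def out_nbrs_def)
      then show ?thesis by (simp add: in_degree_in_nbrs out_degree_out_nbrs half)
    next
      case 4
      then have "{w. (w, u) \<in> parcs D} = U - U1" "out_nbrs D u = U1"
        using U1(1) W1(1) not_both by (auto simp: D_def out_nbrs_def)
      then show ?thesis by (simp add: in_degree_in_nbrs out_degree_out_nbrs half)
    qed
  qed
  ultimately have "eulerian_orientation D K" by (simp add: eulerian_orientation_def)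
  moreover have "digraph_iso (with_proj D) (with_proj (cycle4_blow_up (card U) (card W)))"
  proof (rule four_colouring_iso[OF fin disj])
    show "2 * card U1 = card U" "2 * card W1 = card W" using U1 W1 even by auto
    show "parcs D \<subseteq> pverts D \<times> pverts D" using U1(1) W1(1) by (auto simp: D_def)
    fix u w assume "u \<in> U \<union> W" "w \<in> U \<union> W"
    then show "(u, w) \<in> parcs D \<longleftrightarrow>
        (four_colouring U U1 W1 u, four_colouring U U1 W1 w) \<in> parcs (directed_cycle 4)"
      using U1(1) W1(1) disj by (auto simp: D_def directed_cycle_4 four_colouring_def)
  qed (use U1 W1 in \<open>auto simp: D_def\<close>)
  ultimately show ?thesis by blast
qed

theorem theorem1p12:
  fixes n m :: nat and K :: "'a pair_pre_digraph" and r :: 'a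
  assumes "0 < n" "even n" "0 < m" "even m"
    and "complete_bipartite_digraph n m (with_proj K)"
    and "r \<in> pverts K"
  shows
    "(\<forall>D. eulerian_orientation D K \<longrightarrow> (m div 2) ^ (n - 1) * (n div 2) ^ (m - 1) \<le> arb D r) \<and>
     (\<exists>D. eulerian_orientation D K \<and>
        digraph_iso (with_proj D) (with_proj (cycle4_blow_up n m))) \<and>
     (\<forall>D. eulerian_orientation D K \<longrightarrow>
        digraph_iso (with_proj D) (with_proj (cycle4_blow_up n m)) \<longrightarrow>
        arb D r = (m div 2) ^ (n - 1) * (n div 2) ^ (m - 1)) \<and>
     (\<forall>D. eulerian_orientation D K \<longrightarrow>
        (\<forall>D'. eulerian_orientation D' K \<longrightarrow> arb D r \<le> arb D' r) \<longrightarrow>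
        digraph_iso (with_proj D) (with_proj (cycle4_blow_up n m)))"
proof -
  obtain U W where K: "finite (pverts K)" "pverts K = U \<union> W" "U \<inter> W = {}" "card U = n" "card W = m"
    "parcs K = U \<times> W \<union> W \<times> U"
    using assms(5) unfolding complete_bipartite_digraph_pair_def by blast
  have fin: "finite U" "finite W" using K(1,2) by auto
  have nonempty: "U \<noteq> {}" "W \<noteq> {}" using assms(1,3) K(4,5) by auto
  have r: "r \<in> U \<union> W" using assms(6) K(2) by simp
  let ?b = "(m div 2) ^ (n - 1) * (n div 2) ^ (m - 1)"
  let ?iso = "\<lambda>D :: 'a pair_pre_digraph. digraph_iso (with_proj D) (with_proj (cycle4_blow_up n m))"
  have bound: "?b \<le> arb D r" and eq: "arb D r = ?b \<longleftrightarrow> ?iso D" if "eulerian_orientation D K" for D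
  proof -
    interpret bipartite_eulerian K D U W
      using fin K(2,3,6) that by unfold_locales
    show "?b \<le> arb D r" "arb D r = ?b \<longleftrightarrow> ?iso D"
      using arb_bound[OF nonempty r] assms(2,4) K(4,5) by simp_all
  qed
  obtain D0 where D0: "eulerian_orientation D0 K" "?iso D0"
    using eulerian_orientation_exists[OF fin K(3,2,6)] assms(2,4) K(4,5) by auto
  have "?iso D" if "eulerian_orientation D K" "\<forall>D'. eulerian_orientation D' K \<longrightarrow> arb D r \<le> arb D' r" for D
  proof -
    have "arb D r \<le> ?b" using that(2) D0 eq[OF D0(1)] by metis
    then show ?thesis using bound[OF that(1)] eq[OF that(1)] by simp
  qed
  then show ?thesis using bound eq D0 by blast
qed

end
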